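(* Let $r\ge1$ and let $\lambda=(\lambda_1,\dots,\lambda_{r+1})\in\mathbb{R}^{r+1}$ with $\lambda_i>\lambda_{i+1}$ for $i=1,\dots,r$. The $r!$ polytopes $\{\mathbf{C}_\lambda(u)\}_{u\in\mathbb{S}_r}$ are combinatorial cubes that are the maximal faces of a polyhedral subdivision of $\mathrm{Perm}(\lambda)$. The facet description of $\mathbf{C}_\lambda(u)$ is given by $$\text{(left)}\quad t_{u_i}+\sum_{j\in L(u,i)}t_{u_j}\le\lambda_{i-f_i}+\cdots+\lambda_i,$$ $$\text{(right)}\quad t_{u_i}+\sum_{j\in R(u,i)}t_{u_j}\ge\lambda_{i+1}+\cdots+\lambda_{i+g_i+1},$$ for $i=1,\dots,r$.
   Context: For $\sigma\in\mathbb{S}_{r+1}$ put $\lambda_\sigma=(\lambda_{\sigma(1)},\dots,\lambda_{\sigma(r+1)})\in\mathbb{R}^{r+1}$. The permutahedron $\mathrm{Perm}(\lambda)$ is the convex hull of all $\lambda_\sigma$, $\sigma\in\mathbb{S}_{r+1}$. It lies in the hyperplane $\{(t_1,\dots,t_{r+1})\in\mathbb{R}^{r+1}: t_1+\cdots+t_{r+1}=\lambda_1+\cdots+\lambda_{r+1}\}$, and the facet inequalities are understood inside this hyperplane, with $t_1,\dots,t_{r+1}$ the coordinates of $\mathbb{R}^{r+1}$. Embed $\mathbb{S}_r$ in $\mathbb{S}_{r+1}$ as the permutations fixing $r+1$; permutations are multiplied from right to left and $s_i$ is the transposition $(i\ i+1)$. For $u\in\mathbb{S}_r$ let $I_u=[u,s_1s_2\cdots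 s_ru]$ be the interval in the Bruhat order of $\mathbb{S}_{r+1}$; in one-line notation its bottom element is $u_1,\dots,u_r,r+1$ and its top element is $u_1+1,\dots,u_r+1,1$. The polytope $\mathbf{C}_\lambda(u)$ is the convex hull of the points $\lambda_v$, $v\in I_u$. A combinatorial cube is a polytope whose face lattice is isomorphic to that of a cube (here the $r$-dimensional cube). For $u=u_1\cdots u_r\in\mathbb{S}_r$ (one-line notation) and $i\in\{1,\dots,r\}$, let $L(u,i)=\{i-f_i,\dots,i-1\}$ and $R(u,i)=\{i+1,\dots,i+g_i\}$, where $f_i,g_i\ge0$ are maximal such that $u_j<u_i$ for all $j\in L(u,i)\cup R(u,i)$ (these being subsets of $\{1,\dots,r\}$).
   Formalization: The inequalities written with u are proved to be the facet description of C_λ(u⁻¹) rather than of C_λ(u); with the stated conventions the literal claim fails, e.g. for r=3, u=231, where λ_u has t_2=λ_3<λ_2. *)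

theory Defs
  imports "HOL-Analysis.Analysis" "HOL-Combinatorics.Combinatorics"
begin

text \<open>
  The symmetric group on \<open>{1..n}\<close> is \<open>{w. w permutes {1..n}}\<close>, with \<open>w\<^sub>i = w i\<close> in one-line notation
  and \<open>v \<circ> w\<close> as product (right to left).  Since a permutation of \<open>{1..r}\<close> fixes \<open>r + 1\<close>, it is
  already an element of the symmetric group on \<open>{1..r+1}\<close>.

  The space of vectors \<open>(t\<^sub>1, ..., t\<^sub>n)\<close> is \<open>real ^ 'n\<close> together with a labelling \<open>e\<close>, a bijection
  from \<open>{1..n}\<close> onto the index type; the coordinate \<open>t\<^sub>i\<close> is \<open>t $ e i\<close>.
\<close>

subsection \<open>Bruhat order\<close>

definition inversions :: "nat \<Rightarrow> (nat \<Rightarrow> nat) \<Rightarrow> nat" where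
  "inversions n w = card {(i, j). 1 \<le> i \<and> i < j \<and> j \<le> n \<and> w j < w i}"

definition bruhat_step :: "nat \<Rightarrow> (nat \<Rightarrow> nat) \<Rightarrow> (nat \<Rightarrow> nat) \<Rightarrow> bool" where
  "bruhat_step n v w \<longleftrightarrow>
     (\<exists>a\<in>{1..n}. \<exists>b\<in>{1..n}. w = v \<circ> Transposition.transpose a b) \<and> inversions n v < inversions n w"

definition bruhat_le :: "nat \<Rightarrow> (nat \<Rightarrow> nat) \<Rightarrow> (nat \<Rightarrow> nat) \<Rightarrow> bool" where
  "bruhat_le n v w \<longleftrightarrow> v permutes {1..n} \<and> w permutes {1..n} \<and> (bruhat_step n)\<^sup>*\<^sup>* v w"

text \<open>\<open>coxeter_elt r\<close> is the product \<open>s\<^sub>1 s\<^sub>2 ... s\<^sub>r\<close> of the transpositions \<open>s\<^sub>i = (i i+1)\<close>.\<close>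

primrec coxeter_elt :: "nat \<Rightarrow> nat \<Rightarrow> nat" where
  "coxeter_elt 0 = id"
| "coxeter_elt (Suc r) = coxeter_elt r \<circ> Transposition.transpose (Suc r) (Suc (Suc r))"

lemma coxeter_elt_apply:
  "coxeter_elt r i = (if 1 \<le> i \<and> i \<le> r then i + 1 else if i = r + 1 then 1 else i)"
  by (induction r arbitrary: i) (auto simp: Transposition.transpose_def)

definition cube_interval :: "nat \<Rightarrow> (nat \<Rightarrow> nat) \<Rightarrow> (nat \<Rightarrow> nat) set" where
  "cube_interval r u = {v. bruhat_le (r + 1) u v \<and> bruhat_le (r + 1) v (coxeter_elt r \<circ> u)}"

subsection \<open>The polytopes\<close>

definition perm_point :: "(nat \<Rightarrow> 'n::finite) \<Rightarrow> nat \<Rightarrow> (nat \<Rightarrow> real) \<Rightarrow> (nat \<Rightarrow> nat) \<Rightarrow> real ^ 'n" where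
  "perm_point e n lam w = (\<chi> k. lam (w (inv_into {1..n} e k)))"

lemma perm_point_nth:
  assumes "bij_betw e {1..n} UNIV" "i \<in> {1..n}"
  shows "perm_point e n lam w $ e i = lam (w i)"
  using assms by (simp add: perm_point_def bij_betw_def inv_into_f_f)

definition permutahedron :: "(nat \<Rightarrow> 'n::finite) \<Rightarrow> nat \<Rightarrow> (nat \<Rightarrow> real) \<Rightarrow> (real ^ 'n) set" where
  "permutahedron e n lam = convex hull (perm_point e n lam ` {w. w permutes {1..n}})"

definition bruhat_cube :: "(nat \<Rightarrow> 'n::finite) \<Rightarrow> nat \<Rightarrow> (nat \<Rightarrow> real) \<Rightarrow> (nat \<Rightarrow> nat) \<Rightarrow> (real ^ 'n) set" where
  "bruhat_cube e r lam u = convex hull (perm_point e (r + 1) lam ` cube_interval r u)"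

subsection \<open>Combinatorial cubes and polyhedral subdivisions\<close>

definition face_lattice_iso :: "'a::real_vector set \<Rightarrow> 'b::real_vector set \<Rightarrow> bool" where
  "face_lattice_iso P Q \<longleftrightarrow>
     (\<exists>\<phi>. bij_betw \<phi> {F. F face_of P} {G. G face_of Q} \<and>
          (\<forall>F F'. F face_of P \<longrightarrow> F' face_of P \<longrightarrow> (\<phi> F \<subseteq> \<phi> F' \<longleftrightarrow> F \<subseteq> F')))"

text \<open>
  For a set \<open>B\<close> of \<open>d\<close> basis vectors, \<open>cbox 0 (\<Sum>B)\<close> is the standard unit cube of dimension \<open>d\<close>
  in the coordinate subspace spanned by \<open>B\<close>.
\<close>

definition combinatorial_cube :: "nat \<Rightarrow> 'a::euclidean_space set \<Rightarrow> bool" where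
  "combinatorial_cube d P \<longleftrightarrow>
     polytope P \<and> (\<exists>B \<subseteq> (Basis :: 'a set). card B = d \<and> face_lattice_iso P (cbox 0 (\<Sum>B)))"

definition polyhedral_subdivision :: "'a::euclidean_space set set \<Rightarrow> 'a set \<Rightarrow> bool" where
  "polyhedral_subdivision K P \<longleftrightarrow>
     finite K \<and>
     (\<forall>S\<in>K. polytope S) \<and>
     (\<forall>S F. S \<in> K \<and> F face_of S \<longrightarrow> F \<in> K) \<and>
     (\<forall>S\<in>K. \<forall>T\<in>K. (S \<inter> T) face_of S \<and> (S \<inter> T) face_of T) \<and>
     \<Union>K = P"

definition maximal_faces :: "'a set set \<Rightarrow> 'a set set" where
  "maximal_faces K = {S \<in> K. \<forall>T\<in>K. S \<subseteq> T \<longrightarrow> T = S}"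

subsection \<open>Facet inequalities\<close>

text \<open>
  \<open>left_len u i\<close> and \<open>right_len r u i\<close> are the numbers \<open>f\<^sub>i\<close> and \<open>g\<^sub>i\<close>; the conditions \<open>f < i\<close> and
  \<open>i + g \<le> r\<close> keep the two runs inside \<open>{1..r}\<close>.
\<close>

definition left_len :: "(nat \<Rightarrow> nat) \<Rightarrow> nat \<Rightarrow> nat" where
  "left_len u i = (GREATEST f. f < i \<and> (\<forall>j\<in>{i - f..<i}. u j < u i))"

definition right_len :: "nat \<Rightarrow> (nat \<Rightarrow> nat) \<Rightarrow> nat \<Rightarrow> nat" where
  "right_len r u i = (GREATEST g. i + g \<le> r \<and> (\<forall>j\<in>{i<..i + g}. u j < u i))"

definition left_lhs :: "(nat \<Rightarrow> 'n::finite) \<Rightarrow> (nat \<Rightarrow> nat) \<Rightarrow> nat \<Rightarrow> real ^ 'n \<Rightarrow> real" where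
  "left_lhs e u i t = t $ e (u i) + (\<Sum>j\<in>{i - left_len u i..<i}. t $ e (u j))"

definition right_lhs :: "(nat \<Rightarrow> 'n::finite) \<Rightarrow> nat \<Rightarrow> (nat \<Rightarrow> nat) \<Rightarrow> nat \<Rightarrow> real ^ 'n \<Rightarrow> real" where
  "right_lhs e r u i t = t $ e (u i) + (\<Sum>j\<in>{i<..i + right_len r u i}. t $ e (u j))"

definition left_rhs :: "(nat \<Rightarrow> real) \<Rightarrow> (nat \<Rightarrow> nat) \<Rightarrow> nat \<Rightarrow> real" where
  "left_rhs lam u i = (\<Sum>k = i - left_len u i..i. lam k)"

definition right_rhs :: "nat \<Rightarrow> (nat \<Rightarrow> real) \<Rightarrow> (nat \<Rightarrow> nat) \<Rightarrow> nat \<Rightarrow> real" where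
  "right_rhs r lam u i = (\<Sum>k = i + 1..i + right_len r u i + 1. lam k)"

text \<open>
  The facet description says that the inequalities cut \<open>P\<close> out of the hyperplane and that sending
  an inequality to its equality set in \<open>P\<close> is a bijection onto the facets of \<open>P\<close>
  (\<open>Inl i\<close> is the \<open>i\<close>-th left inequality, \<open>Inr i\<close> the \<open>i\<close>-th right one).

  Conventions for inverses: the inequalities written with the one-line notation of \<open>u\<close> are those of
  \<open>bruhat_cube e r lam (inv u)\<close>, not of \<open>bruhat_cube e r lam u\<close>.  Indeed the vertex of the latter at
  the bottom of the interval has coordinates \<open>t\<^sub>i = lam (u i)\<close>, whereas the left inequalities are
  simultaneously tight at \<open>t\<^bsub>u i\<^esub> = lam i\<close>.  For \<open>r = 3\<close> and \<open>u = 231\<close> the former vertex is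
  \<open>(lam 2, lam 3, lam 1, lam 4)\<close> and violates the right inequality \<open>t\<^sub>2 \<ge> lam 2\<close> for \<open>i = 1\<close>.
\<close>

definition facet_description ::
  "(nat \<Rightarrow> 'n::finite) \<Rightarrow> nat \<Rightarrow> (nat \<Rightarrow> real) \<Rightarrow> (nat \<Rightarrow> nat) \<Rightarrow> (real ^ 'n) set \<Rightarrow> bool" where
  "facet_description e r lam u P \<longleftrightarrow>
     P = {t. (\<Sum>i = 1..r + 1. t $ e i) = (\<Sum>i = 1..r + 1. lam i) \<and>
             (\<forall>i\<in>{1..r}. left_lhs e u i t \<le> left_rhs lam u i \<and>
                         right_lhs e r u i t \<ge> right_rhs r lam u i)} \<and>
     bij_betw
       (case_sum (\<lambda>i. {t \<in> P. left_lhs e u i t = left_rhs lam u i})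
                 (\<lambda>i. {t \<in> P. right_lhs e r u i t = right_rhs r lam u i}))
       ({1..r} <+> {1..r}) {F. F facet_of P}"

end

theory Submission
  imports Defs
begin

text \<open>
  The idea is to remove the coordinates \<open>t\<^sub>1, ..., t\<^sub>r\<close> of a point one after another from the decreasing sequence
  \<open>\<lambda>\<^sub>1 > ... > \<lambda>\<^bsub>r+1\<^esub>\<close>.  To remove a number \<open>s\<close>, find adjacent entries \<open>x \<ge> s \<ge> y\<close> and replace this pair by
  the single entry \<open>x + y - s\<close>, which again lies between \<open>x\<close> and \<open>y\<close>.  After \<open>r\<close> steps one entry is left, and it
  equals \<open>t\<^bsub>r+1\<^esub>\<close> because sums are preserved.  If a point is majorised by \<open>\<lambda>\<close>, in particular if it lies in the
  permutahedron, then the process can be carried out, since majorisation of the remaining coordinates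
  persists (\<open>majorised_slots\<close>).
  
  Recording the slots used at the \<open>r\<close> steps gives one of \<open>r!\<close> sequences, which are the Lehmer codes of the
  permutations \<open>u\<close> of \<open>{1..r}\<close>.  The points that can use the slots of \<open>u\<close> form a cell, cut out of a hyperplane by
  \<open>r\<close> pairs of inequalities \<open>y \<le> s \<le> x\<close> in which \<open>x\<close> and \<open>y\<close> are affine functions of the earlier coordinates.
  As \<open>x > y\<close> always holds, a point of the cell is obtained by choosing, at each step independently, the position of
  \<open>s\<close> in a nondegenerate interval.  So the cell has the face lattice of a cube: every pattern of tight
  inequalities that takes at most one from each pair occurs, and patterns describe faces (\<open>cube_system\<close>,
  \<open>cube_systems_face_lattice_iso\<close>).
  
  At a vertex of the cell each \<open>s\<close> is an end of its slot, so each step just deletes an entry.  Hence the vertices are the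
  points \<open>\<lambda>\<^sub>v\<close> whose Lehmer code exceeds that of \<open>u\<close> by 0 or 1 in each entry.  These \<open>v\<close> form the Bruhat interval
  \<open>[u, s\<^sub>1...s\<^sub>r u]\<close> (\<open>cube_interval_iff_code\<close>), so the cell is the cube of \<open>u\<close> (\<open>bruhat_cube_eq_cell\<close>).
  
  Cells overlap only through ties: if \<open>s\<close> equals an entry of the sequence, both adjacent slots may be used, and both
  choices delete that entry and leave the same sequence.  Hence the intersection of two cells is given by tight
  inequalities of either one, that is, it is a common face (\<open>cells_Int_face_of\<close>).
  
  For the facet inequalities, partial sums of the current sequence are differences between partial sums of \<open>\<lambda>\<close> and
  sums of coordinates already removed (\<open>state_prefix_sum\<close>).  In the cell of the inverse of \<open>u\<close>, the two ends of the
  slot used by the coordinate with label \<open>u\<^sub>i\<close> therefore involve precisely the runs of smaller labels next to position \<open>i\<close>, which turns \<open>s \<le> x\<close> into the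
  left and \<open>y \<le> s\<close> into the right inequality (\<open>slacks_eq_facet_inequalities\<close>).
\<close>

section \<open>Lehmer codes and Bruhat intervals\<close>

definition code :: "nat \<Rightarrow> (nat \<Rightarrow> nat) \<Rightarrow> nat \<Rightarrow> nat" where
  "code n v i = card {j \<in> {i<..n}. v j < v i}"

lemma code_le: "code n v i \<le> n - i"
proof -
  have "code n v i \<le> card {i<..n}" unfolding code_def by (intro card_mono) auto
  then show ?thesis by simp
qed

lemma inversions_eq_sum_code: "inversions n v = (\<Sum>i = 1..n. code n v i)"
proof -
  have "{(i, j). 1 \<le> i \<and> i < j \<and> j \<le> n \<and> v j < v i} = (SIGMA i:{1..n}. {j \<in> {i<..n}. v j < v i})"
    by auto
  then show ?thesis by (simp add: inversions_def code_def)
qed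

text \<open>
  Reading a permutation from left to right, the next value is determined by its rank among the
  values not yet used, and that rank is the entry of the code.
\<close>

lemma code_inj:
  assumes v: "v permutes {1..n}" and w: "w permutes {1..n}"
    and eq: "\<And>i. i \<in> {1..n} \<Longrightarrow> code n v i = code n w i"
  shows "v = w"
proof -
  have "i \<in> {1..n} \<longrightarrow> v i = w i" for i
  proof (induction i rule: less_induct)
    case (less i)
    show ?case
    proof
      assume i: "i \<in> {1..n}"
      have img: "p ` {i..n} = {1..n} - p ` {1..<i}" if "p permutes {1..n}" for p
      proof -
        have "p ` ({1..n} - {1..<i}) = p ` {1..n} - p ` {1..<i}"
          by (rule image_set_diff[OF permutes_inj[OF that]])
        moreover have "{1..n} - {1..<i} = {i..n}" using i by auto
        ultimately show ?thesis using permutes_image[OF that] by simp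
      qed
      have "v ` {1..<i} = w ` {1..<i}" using less i by (intro image_cong) auto
      then have S: "v ` {i..n} = w ` {i..n}" using img v w by simp
      have cd: "code n p i = card {x \<in> p ` {i..n}. x < p i}" if "p permutes {1..n}" for p
      proof -
        have "{x \<in> p ` {i..n}. x < p i} = p ` {j \<in> {i<..n}. p j < p i}"
          by (force simp: order.order_iff_strict)
        then show ?thesis
          by (simp add: code_def card_image inj_on_subset[OF permutes_inj[OF that]])
      qed
      define S where "S = v ` {i..n}"
      have mem: "v i \<in> S" "w i \<in> S" using S i by (auto simp: S_def)
      have c: "card {x \<in> S. x < v i} = card {x \<in> S. x < w i}"
        using cd[OF v] cd[OF w] eq[OF i] S by (simp add: S_def)
      have "\<not> a < b" if "a \<in> S" "b \<in> S" "card {x \<in> S. x < a} = card {x \<in> S. x < b}" for a b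
      proof
        assume "a < b"
        then have "{x \<in> S. x < a} \<subset> {x \<in> S. x < b}" using that by auto
        then have "card {x \<in> S. x < a} < card {x \<in> S. x < b}" by (intro psubset_card_mono) (auto simp: S_def)
        then show False using that by simp
      qed
      then show "v i = w i" using mem c by (metis linorder_neqE_nat)
    qed
  qed
  then show ?thesis using v w by (metis ext permutes_not_in)
qed

text \<open>
  There are \<open>n!\<close> admissible codes, as many as permutations, so injectivity is enough.
\<close>

lemma code_surj:
  assumes k: "\<And>i. i \<in> {1..n} \<Longrightarrow> k i + i \<le> n"
  obtains v where "v permutes {1..n}" "\<And>i. i \<in> {1..n} \<Longrightarrow> code n v i = k i"
proof -
  define C where "C v = restrict (code n v) {1..n}" for v
  let ?S = "{v. v permutes {1..n}}" and ?E = "PiE {1..n} (\<lambda>i. {..n - i})"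
  have inj: "inj_on C ?S"
  proof (rule inj_onI, clarsimp)
    fix v w assume "v permutes {Suc 0..n}" "w permutes {Suc 0..n}" "C v = C w"
    moreover have "code n v i = code n w i" if "i \<in> {1..n}" for i
      using fun_cong[OF \<open>C v = C w\<close>, of i] that by (simp add: C_def)
    ultimately show "v = w" by (intro code_inj) auto
  qed
  have sub: "C ` ?S \<subseteq> ?E" using code_le by (auto simp: C_def)
  have "card ?E = (\<Prod>i = 1..n. Suc (n - i))" by (simp add: card_PiE)
  also have "\<dots> = (\<Prod>i = 1..n. i)"
    by (rule prod.reindex_bij_witness[of _ "\<lambda>i. Suc n - i" "\<lambda>i. Suc n - i"]) auto
  also have "\<dots> = fact n" by (simp add: fact_prod)
  finally have "card ?E = card (C ` ?S)"
    using card_image[OF inj] card_permutations[of "{1..n}" n] by simp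
  moreover have "finite ?E" by (auto intro: finite_PiE)
  ultimately have "C ` ?S = ?E" using sub card_subset_eq by metis
  moreover have "restrict k {1..n} \<in> ?E" using k by (force simp: le_diff_conv2)
  ultimately have "restrict k {1..n} \<in> C ` ?S" by simp
  then obtain v where v: "v permutes {1..n}" "restrict k {1..n} = C v" by blast
  have "code n v i = k i" if "i \<in> {1..n}" for i
    using fun_cong[OF v(2), of i] that by (simp add: C_def)
  then show ?thesis using that v by blast
qed

text \<open>
  Exchanging \<open>v i\<close> with the next smaller value occurring to its right exchanges two values that are
  adjacent in the suffix starting at \<open>i\<close>.  No comparison inside that suffix changes except the one
  between the two exchanged positions, so a single entry of the code drops, by one.
\<close>

lemma code_decrement:
  assumes v: "v permutes {1..n}" and i: "i \<in> {1..n}" and pos: "0 < code n v i"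
  obtains v' where "v' permutes {1..n}" "\<And>j. j \<in> {1..n} \<Longrightarrow> code n v' j = (if j = i then code n v i - 1 else code n v j)"
    "bruhat_step n v' v"
proof -
  define S where "S = {j \<in> {i<..n}. v j < v i}"
  have S: "finite S" "S \<noteq> {}" using pos by (auto simp: S_def code_def card_gt_0_iff)
  \<comment> \<open>The position to the right of \<open>i\<close> that carries the largest value below \<open>v i\<close>.\<close>
  obtain b where b: "b \<in> S" "\<And>j. j \<in> S \<Longrightarrow> v j \<le> v b"
    using Max_in[of "v ` S"] Max_ge[of "v ` S"] S by fastforce
  have bi: "i < b" "b \<le> n" "v b < v i" using b by (auto simp: S_def)
  \<comment> \<open>No value strictly between \<open>v b\<close> and \<open>v i\<close> occurs to the right of \<open>i\<close>.\<close>
  have gap: "v l < v b \<or> v i < v l" if "l \<in> {i<..n}" "l \<noteq> b" for l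
  proof -
    have "v l \<noteq> v i" "v l \<noteq> v b" using that permutes_inj[OF v] bi by (auto simp: inj_eq)
    then show ?thesis using b(2)[of l] that by (force simp: S_def)
  qed
  define w where "w = v \<circ> Transposition.transpose i b"
  have w_at: "w i = v b" "w b = v i" "\<And>l. l \<noteq> i \<Longrightarrow> l \<noteq> b \<Longrightarrow> w l = v l"
    by (auto simp: w_def)
  have wp: "w permutes {1..n}" unfolding w_def
    using v i bi by (intro permutes_compose permutes_swap_id) auto
  have cd: "code n w j = (if j = i then code n v i - 1 else code n v j)" if j: "j \<in> {1..n}" for j
  proof -
    consider "j < i" | "j = i" | "i < j" "j \<noteq> b" | "j = b" by linarith
    then show ?thesis
    proof cases
      case 1
      have "{l \<in> {j<..n}. w l < w j} = Transposition.transpose i b ` {l \<in> {j<..n}. v l < v j}" (is "?L = ?t ` ?R")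
      proof
        show "?t ` ?R \<subseteq> ?L" using 1 bi by (auto simp: w_def Transposition.transpose_def)
        show "?L \<subseteq> ?t ` ?R"
        proof
          fix l assume l: "l \<in> ?L"
          have "?t l \<in> ?R" using l 1 bi by (auto simp: w_def Transposition.transpose_def split: if_splits)
          then show "l \<in> ?t ` ?R" by (metis image_eqI transpose_involutory)
        qed
      qed
      then have "card ?L = card ?R" by (simp add: card_image)
      then show ?thesis using 1 by (simp add: code_def)
    next
      case 2
      have "{l \<in> {i<..n}. w l < w i} = S - {b}"
      proof -
        have "w l < w i \<longleftrightarrow> v l < v i \<and> l \<noteq> b" if "l \<in> {i<..n}" for l
          using that gap[OF that] w_at bi by (cases "l = b") auto
        then show ?thesis by (auto simp: S_def)
      qed
      then show ?thesis using 2 b S by (simp add: code_def S_def)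
    next
      case 3
      have "w l < w j \<longleftrightarrow> v l < v j" if "l \<in> {j<..n}" for l
        using that gap[of j] 3 w_at bi j by (cases "l = b") auto
      then have "{l \<in> {j<..n}. w l < w j} = {l \<in> {j<..n}. v l < v j}" by blast
      then show ?thesis using 3 by (simp add: code_def)
    next
      case 4
      have "w l < w j \<longleftrightarrow> v l < v j" if "l \<in> {j<..n}" for l
        using that gap[of l] 4 w_at bi by auto
      then have "{l \<in> {j<..n}. w l < w j} = {l \<in> {j<..n}. v l < v j}" by blast
      then show ?thesis using 4 bi by (simp add: code_def)
    qed
  qed
  have "inversions n w < inversions n v"
    unfolding inversions_eq_sum_code using i pos cd by (intro sum_strict_mono_ex1) auto
  moreover have "v = w \<circ> Transposition.transpose i b" by (auto simp: w_def comp_assoc)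
  ultimately have "bruhat_step n w v"
    unfolding bruhat_step_def using i bi by fastforce
  then show ?thesis using that wp cd by blast
qed

text \<open>
  Lowering one code entry at a time leads from \<open>w\<close> down to \<open>v\<close>.
\<close>

lemma bruhat_le_if_code_le:
  assumes "v permutes {1..n}" "w permutes {1..n}" "\<And>i. i \<in> {1..n} \<Longrightarrow> code n v i \<le> code n w i"
  shows "bruhat_le n v w"
  using assms(2,3)
proof (induction "inversions n w" arbitrary: w rule: less_induct)
  case less
  show ?case
  proof (cases "\<forall>i\<in>{1..n}. code n v i = code n w i")
    case True
    then have "v = w" using code_inj assms less.prems by blast
    then show ?thesis using assms by (simp add: bruhat_le_def)
  next
    case False
    then obtain i where i: "i \<in> {1..n}" "code n v i < code n w i" using less.prems by fastforce
    then have "0 < code n w i" by simp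
    then obtain w' where w': "w' permutes {1..n}"
      "\<And>j. j \<in> {1..n} \<Longrightarrow> code n w' j = (if j = i then code n w i - 1 else code n w j)" "bruhat_step n w' w"
      using code_decrement[OF less.prems(1) i(1)] by blast
    have "bruhat_le n v w'"
      using w' i less.prems by (intro less.hyps) (auto simp: bruhat_step_def)
    then show ?thesis using w' less.prems
      by (auto simp: bruhat_le_def intro: rtranclp.rtrancl_into_rtrancl)
  qed
qed

text \<open>
  Undoing an inversion does not create inversions in total: the map \<open>\<phi>\<close> below transports an
  inversion of the new permutation along the transposition whenever the order of the two positions
  survives, and leaves it alone otherwise.
\<close>

lemma inversions_transpose_le:
  assumes ab: "1 \<le> a" "a < b" "b \<le> n" "v b < v a"
  shows "inversions n (v \<circ> Transposition.transpose a b) \<le> inversions n v"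
proof -
  define w where "w = v \<circ> Transposition.transpose a b"
  let ?t = "Transposition.transpose a b"
  define \<phi> where "\<phi> = (\<lambda>(i, j). if ?t i < ?t j then (?t i, ?t j) else (i, j))"
  let ?Inv = "\<lambda>w. {(i, j). 1 \<le> i \<and> i < j \<and> j \<le> n \<and> w j < w i}"
  have "card (?Inv w) \<le> card (?Inv v)"
  proof (rule card_inj_on_le[where f = \<phi>])
    show "inj_on \<phi> (?Inv w)"
    proof (rule inj_onI)
      fix x y assume "x \<in> ?Inv w" "y \<in> ?Inv w" and eq: "\<phi> x = \<phi> y"
      moreover obtain i j i' j' where "x = (i, j)" "y = (i', j')" by (cases x, cases y)
      ultimately have ij: "i < j" "i' < j'" "x = (i, j)" "y = (i', j')" by auto
      show "x = y"
      proof (cases "?t i < ?t j"; cases "?t i' < ?t j'")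
        assume "?t i < ?t j" "?t i' < ?t j'"
        then have "?t i = ?t i'" "?t j = ?t j'" using eq ij by (simp_all add: \<phi>_def)
        then have "?t (?t i) = ?t (?t i')" "?t (?t j) = ?t (?t j')" by simp_all
        then show ?thesis using ij by simp
      next
        assume n: "?t i < ?t j" "\<not> ?t i' < ?t j'"
        then have "i' = ?t i" "j' = ?t j" using eq ij by (simp_all add: \<phi>_def)
        then show ?thesis using n ij by simp
      next
        assume n: "\<not> ?t i < ?t j" "?t i' < ?t j'"
        then have "i = ?t i'" "j = ?t j'" using eq ij by (simp_all add: \<phi>_def)
        then show ?thesis using n ij by simp
      next
        assume "\<not> ?t i < ?t j" "\<not> ?t i' < ?t j'"
        then show ?thesis using eq ij by (simp add: \<phi>_def)
      qed
    qed
    show "\<phi> ` ?Inv w \<subseteq> ?Inv v"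
    proof (rule image_subsetI)
      fix x assume "x \<in> ?Inv w"
      then obtain i j where x: "x = (i, j)" and ij: "1 \<le> i" "i < j" "j \<le> n" "w j < w i" by auto
      have "w a = v b" "w b = v a" "\<And>l. l \<noteq> a \<Longrightarrow> l \<noteq> b \<Longrightarrow> w l = v l"
        by (auto simp: w_def)
      then show "\<phi> x \<in> ?Inv v"
        using ij ab x unfolding \<phi>_def
        by (cases "i = a"; cases "i = b"; cases "j = a"; cases "j = b") (simp_all add: transpose_eq_iff)
    qed
    have "?Inv v \<subseteq> {1..n} \<times> {1..n}" by auto
    then show "finite (?Inv v)" by (rule finite_subset) auto
  qed
  then show ?thesis by (simp add: inversions_def w_def)
qed

definition small_suffix_count :: "nat \<Rightarrow> (nat \<Rightarrow> nat) \<Rightarrow> nat \<Rightarrow> nat \<Rightarrow> nat" where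
  "small_suffix_count n v q p = card {i \<in> {q..n}. v i \<le> p}"

text \<open>
  The easy half of the tableau criterion.  A Bruhat step moves the smaller of two values to the right,
  so it can only increase the number of small values in a suffix.
\<close>

lemma small_suffix_count_step:
  assumes "v permutes {1..n}" "bruhat_step n v w" "1 \<le> q"
  shows "small_suffix_count n v q p \<le> small_suffix_count n w q p"
proof -
  obtain a b where ab: "1 \<le> a" "a < b" "b \<le> n" "w = v \<circ> Transposition.transpose a b"
    and inv: "inversions n v < inversions n w"
  proof -
    obtain a b where "a\<in>{1..n}" "b\<in>{1..n}" "w = v \<circ> Transposition.transpose a b" "inversions n v < inversions n w"
      using assms(2) unfolding bruhat_step_def by blast
    then show ?thesis using that[of a b] that[of b a]
      by (cases a b rule: linorder_cases) (auto simp: transpose_commute)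
  qed
  have "v a \<noteq> v b" using ab permutes_inj[OF assms(1)] by (auto simp: inj_eq)
  then have lt: "v a < v b" using inversions_transpose_le[of a b n v] ab inv by force
  let ?t = "Transposition.transpose a b"
  let ?V = "{i \<in> {q..n}. v i \<le> p}" and ?W = "{i \<in> {q..n}. w i \<le> p}"
  show ?thesis
  proof (cases "q \<le> a")
    case True
    have "?t ` ?V \<subseteq> ?W" using True ab by (auto simp: Transposition.transpose_def)
    then have "card (?t ` ?V) \<le> card ?W" by (intro card_mono) auto
    then show ?thesis by (simp add: small_suffix_count_def card_image)
  next
    case False
    then have "?V \<subseteq> ?W" using ab lt by (auto simp: Transposition.transpose_def)
    then show ?thesis unfolding small_suffix_count_def by (intro card_mono) auto
  qed
qed

lemma small_suffix_count_mono:
  assumes "bruhat_le n v w" "1 \<le> q"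
  shows "small_suffix_count n v q p \<le> small_suffix_count n w q p"
proof -
  have v: "v permutes {1..n}" and "(bruhat_step n)\<^sup>*\<^sup>* v w" using assms by (auto simp: bruhat_le_def)
  from this(2) have "w permutes {1..n} \<and> small_suffix_count n v q p \<le> small_suffix_count n w q p"
  proof (induction rule: rtranclp_induct)
    case (step y z)
    have "z permutes {1..n}" using step unfolding bruhat_step_def
      by (auto intro!: permutes_compose permutes_swap_id)
    moreover have "small_suffix_count n y q p \<le> small_suffix_count n z q p"
      using step assms small_suffix_count_step by blast
    ultimately show ?case using step by linarith
  qed (use v in simp)
  then show ?thesis by blast
qed

lemma code_extend:
  assumes u: "u permutes {1..r}" and i: "i \<in> {1..r}"
  shows "code (r + 1) u i = code r u i" "code (r + 1) (coxeter_elt r \<circ> u) i = code r u i + 1"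
proof -
  have ur: "u j \<in> {1..r}" if "j \<in> {1..r}" for j using u that permutes_in_image by metis
  have top: "u (Suc r) = Suc r" using u by (simp add: permutes_not_in)
  have "{j \<in> {i<..r + 1}. u j < u i} = {j \<in> {i<..r}. u j < u i}"
    using ur[OF i] top by (auto simp: le_Suc_eq)
  then show "code (r + 1) u i = code r u i" by (simp add: code_def)
  have c: "coxeter_elt r (u j) = u j + 1" if "j \<in> {1..r}" for j
    using ur[OF that] by (simp add: coxeter_elt_apply)
  have c_top: "coxeter_elt r (u (Suc r)) = 1" by (simp add: top coxeter_elt_apply)
  have "{j \<in> {i<..r + 1}. (coxeter_elt r \<circ> u) j < (coxeter_elt r \<circ> u) i} = insert (r + 1) {j \<in> {i<..r}. u j < u i}"
    using i c c_top ur[OF i] by (auto simp: le_Suc_eq)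
  then show "code (r + 1) (coxeter_elt r \<circ> u) i = code r u i + 1" by (simp add: code_def)
qed

lemma coxeter_elt_permutes: "coxeter_elt r permutes {1..r + 1}"
proof (induction r)
  case (Suc r)
  have "coxeter_elt r permutes {1..Suc r + 1}" using Suc by (rule permutes_subset) auto
  moreover have "Transposition.transpose (Suc r) (Suc (Suc r)) permutes {1..Suc r + 1}"
    by (rule permutes_swap_id) auto
  ultimately show ?case unfolding coxeter_elt.simps by (rule permutes_compose[rotated])
qed (simp add: id_def permutes_id[unfolded id_def])

text \<open>
  The rank inequalities for the bottom and for the top of the interval say that the sorted values
  \<open>V\<^sub>1 < V\<^sub>2 < ...\<close> of \<open>v\<close> and \<open>U\<^sub>1 < U\<^sub>2 < ...\<close> of \<open>u\<close> on a suffix interlace: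
  \<open>V\<^sub>1 \<le> U\<^sub>1 < V\<^sub>2 \<le> U\<^sub>2 < ...\<close>.  Passing from the suffix at \<open>i\<close> to the one at \<open>i + 1\<close> deletes one
  value from each sequence.  Both sequences can only stay interlaced if the ranks of the deleted values,
  which are the code entries, agree or the rank in \<open>v\<close> is larger by one.
\<close>

lemma interval_code_bounds:
  assumes u: "u permutes {1..r}" and v: "v \<in> cube_interval r u" and i: "i \<in> {1..r}"
  shows "code (r + 1) v i \<in> {code r u i, code r u i + 1}"
proof -
  define n where "n = r + 1"
  have vp: "v permutes {1..n}" using v by (simp add: cube_interval_def bruhat_le_def n_def)
  have ur: "u j \<in> {1..r}" if "j \<in> {1..r}" for j using u that permutes_in_image by metis
  have top: "u (Suc r) = Suc r" using u by (simp add: permutes_not_in)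
  define f where "f q p = card {j \<in> {q..r}. u j \<le> p}" for q p
  define g where "g q p = small_suffix_count n v q p" for q p
  \<comment> \<open>The two Bruhat bounds say that the values of \<open>u\<close> and of \<open>v\<close> on every suffix interlace.\<close>
  have A: "f q p \<le> g q p" if "1 \<le> q" "p \<le> r" for q p
  proof -
    have "{j \<in> {q..n}. u j \<le> p} = {j \<in> {q..r}. u j \<le> p}"
      using that top by (auto simp: n_def le_Suc_eq)
    then show ?thesis
      using small_suffix_count_mono[of n u v q p] v that
      by (simp add: cube_interval_def n_def f_def g_def small_suffix_count_def)
  qed
  have B: "g q p \<le> f q (p - 1) + 1" if "1 \<le> q" "1 \<le> p" for q p
  proof -
    have "{j \<in> {q..n}. (coxeter_elt r \<circ> u) j \<le> p} \<subseteq> insert n {j \<in> {q..r}. u j \<le> p - 1}"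
    proof
      fix j assume j: "j \<in> {j \<in> {q..n}. (coxeter_elt r \<circ> u) j \<le> p}"
      show "j \<in> insert n {j \<in> {q..r}. u j \<le> p - 1}"
      proof (cases "j = n")
        case False
        then have "j \<in> {1..r}" using j that by (auto simp: n_def)
        then show ?thesis using j ur[of j] by (auto simp: coxeter_elt_apply)
      qed simp
    qed
    then have "small_suffix_count n (coxeter_elt r \<circ> u) q p \<le> card (insert n {j \<in> {q..r}. u j \<le> p - 1})"
      unfolding small_suffix_count_def by (intro card_mono) auto
    also have "\<dots> \<le> f q (p - 1) + 1" by (simp add: f_def card_insert_if)
    finally show ?thesis
      using small_suffix_count_mono[of n v "coxeter_elt r \<circ> u" q p] v that
      by (simp add: cube_interval_def n_def g_def)
  qed
  define k P h c where "k = u i" and "P = v i" and "h = code r u i" and "c = code n v i"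
  have k: "k \<in> {1..r}" using ur i by (simp add: k_def)
  have P: "P \<in> {1..n}" using vp i permutes_in_image[of v "{1..n}" i] by (simp add: P_def n_def)
  have fk: "f i p = f (i + 1) p + (if k \<le> p then 1 else 0)" for p
  proof -
    have "{j \<in> {i..r}. u j \<le> p} = (if k \<le> p then insert i {j \<in> {i+1..r}. u j \<le> p} else {j \<in> {i+1..r}. u j \<le> p})"
    proof -
      have "{i..r} = insert i {i+1..r}" using i by auto
      then show ?thesis by (auto simp: k_def)
    qed
    then show ?thesis by (simp add: f_def)
  qed
  have gP: "g i p = g (i + 1) p + (if P \<le> p then 1 else 0)" for p
  proof -
    have "{j \<in> {i..n}. v j \<le> p} = (if P \<le> p then insert i {j \<in> {i+1..n}. v j \<le> p} else {j \<in> {i+1..n}. v j \<le> p})"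
    proof -
      have "{i..n} = insert i {i+1..n}" using i by (auto simp: n_def)
      then show ?thesis by (auto simp: P_def)
    qed
    then show ?thesis by (simp add: g_def small_suffix_count_def)
  qed
  have h: "h = f (i + 1) (k - 1)" "h = f i (k - 1)"
  proof -
    have "{j \<in> {i<..r}. u j < u i} = {j \<in> {i+1..r}. u j \<le> k - 1}" using k by (auto simp: k_def)
    then show "h = f (i + 1) (k - 1)" by (simp add: h_def code_def f_def)
    then show "h = f i (k - 1)" using fk[of "k - 1"] k by auto
  qed
  have c: "c = g (i + 1) (P - 1)"
  proof -
    have "{j \<in> {i<..n}. v j < v i} = {j \<in> {i+1..n}. v j \<le> P - 1}" using P by (auto simp: P_def)
    then show ?thesis by (simp add: c_def code_def g_def small_suffix_count_def)
  qed
  have f_mono: "f q p \<le> f q p'" if "p \<le> p'" for q p p'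
    unfolding f_def using that by (intro card_mono) auto
  have g_mono: "g q p \<le> g q p'" if "p \<le> p'" for q p p'
    unfolding g_def small_suffix_count_def using that by (intro card_mono) auto
  have f0: "f q 0 = 0" if "1 \<le> q" for q
  proof -
    have "\<not> u j \<le> 0" if "j \<in> {q..r}" for j
      using ur[of j] that \<open>1 \<le> q\<close> by auto
    then have "{j \<in> {q..r}. u j \<le> 0} = {}" by blast
    then show ?thesis by (simp add: f_def)
  qed
  have i1: "1 \<le> i" using i by simp
  have fk_at: "f i k = h + 1"
  proof -
    have "{j \<in> {i+1..r}. u j \<le> k} = {j \<in> {i+1..r}. u j \<le> k - 1}"
    proof -
      have "u j \<noteq> k" if "j \<in> {i+1..r}" for j
        using that permutes_inj[OF u] by (auto simp: k_def inj_eq)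
      then show ?thesis by force
    qed
    then have "f (i + 1) k = h" by (simp add: h f_def)
    then show ?thesis using fk[of k] by simp
  qed
  have "h \<le> c"
  proof (rule ccontr)
    assume "\<not> h \<le> c"
    then have ch: "c + 1 \<le> h" by simp
    \<comment> \<open>This \<open>p\<close> is the value of rank \<open>c\<close> (counted from 0) of \<open>u\<close> on the suffix; it survives the deletion of \<open>k\<close>.\<close>
    define p where "p = (LEAST p. c + 1 \<le> f i p)"
    have p: "c + 1 \<le> f i p" unfolding p_def by (rule LeastI[of "\<lambda>p. c + 1 \<le> f i p" "k - 1"]) (use ch h(2) in simp)
    have pk: "p \<le> k - 1" unfolding p_def by (rule Least_le) (use ch h(2) in simp)
    have p1: "1 \<le> p" using p f0[OF i1] by (cases p) auto
    have pl: "f i (p - 1) \<le> c"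
      using not_less_Least[of "p - 1" "\<lambda>p. c + 1 \<le> f i p"] p1 unfolding p_def[symmetric] by simp
    have "f i p = f (i + 1) p" using fk[of p] pk k by auto
    moreover have "p \<le> r" using pk k by auto
    ultimately have g1: "c + 1 \<le> g (i + 1) p" using A[of "i+1" p] p by auto
    show False
    proof (cases "P \<le> p")
      case True
      then show False using gP[of p] g1 B[OF i1 p1] pl by simp
    next
      case False
      then have "p \<le> P - 1" by simp
      then show False using g_mono[of p "P - 1" "i + 1"] g1 c by simp
    qed
  qed
  moreover have "c \<le> h + 1"
  proof (rule ccontr)
    assume "\<not> c \<le> h + 1"
    then have ch: "h + 1 < c" by simp
    have fr: "c \<le> f i r"
    proof -
      have "{j \<in> {i..r}. u j \<le> r} = {i..r}" using ur i by force
      then show ?thesis using code_le[of n v i] i by (simp add: f_def c_def n_def)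
    qed
    \<comment> \<open>The \<open>c\<close>-th smallest value of \<open>u\<close> on the suffix; it exceeds \<open>k\<close>, so deleting \<open>k\<close> lowers its rank.\<close>
    define p where "p = (LEAST p. c \<le> f i p)"
    have p: "c \<le> f i p" unfolding p_def using fr by (rule LeastI)
    have pr: "p \<le> r" unfolding p_def using fr by (rule Least_le)
    have pk: "k < p"
    proof (rule ccontr)
      assume "\<not> k < p" then have "f i p \<le> f i k" by (intro f_mono) simp
      then show False using p ch fk_at by simp
    qed
    have "f i (p - 1) < c"
      using not_less_Least[of "p - 1" "\<lambda>p. c \<le> f i p"] pk unfolding p_def[symmetric] by simp
    moreover have "k \<le> p - 1" using pk by simp
    ultimately have "f (i + 1) (p - 1) + 2 \<le> c" using fk[of "p - 1"] by simp
    then have g1: "g (i + 1) p < c" using B[of "i + 1" p] pk by simp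
    have "c \<le> g i p" using A[OF i1 pr] p by simp
    then have "P \<le> p" using g1 gP[of p] by (auto split: if_splits)
    then have "P - 1 \<le> p" by simp
    then show False using g_mono[of "P - 1" p "i + 1"] g1 c by simp
  qed
  ultimately show ?thesis by (auto simp: h_def c_def n_def)
qed

text \<open>
  The interval is a product of two-element sets in code coordinates: by \<open>code_extend\<close>, multiplication
  by the Coxeter element raises each of the first \<open>r\<close> entries by one, and any choice of raised entries
  lies between the two ends.
\<close>

lemma cube_interval_iff_code:
  assumes u: "u permutes {1..r}"
  shows "v \<in> cube_interval r u \<longleftrightarrow> v permutes {1..r + 1} \<and>
    (\<forall>i\<in>{1..r}. code (r + 1) v i \<in> {code r u i, code r u i + 1})"
proof
  assume "v \<in> cube_interval r u"
  then show "v permutes {1..r + 1} \<and> (\<forall>i\<in>{1..r}. code (r + 1) v i \<in> {code r u i, code r u i + 1})"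
    using interval_code_bounds[OF u] by (simp add: cube_interval_def bruhat_le_def)
next
  assume v: "v permutes {1..r + 1} \<and> (\<forall>i\<in>{1..r}. code (r + 1) v i \<in> {code r u i, code r u i + 1})"
  have last: "code (r + 1) w (r + 1) = 0" for w by (simp add: code_def)
  have bnd: "code (r + 1) u i \<le> code (r + 1) v i \<and> code (r + 1) v i \<le> code (r + 1) (coxeter_elt r \<circ> u) i"
    if "i \<in> {1..r + 1}" for i
  proof (cases "i = r + 1")
    case False
    then have "i \<in> {1..r}" using that by auto
    then have "code (r + 1) v i \<in> {code r u i, code r u i + 1}" using v by blast
    then show ?thesis using code_extend[OF u \<open>i \<in> {1..r}\<close>] by auto
  qed (use last in simp)
  have u1: "u permutes {1..r + 1}" using u by (rule permutes_subset) auto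
  then have "coxeter_elt r \<circ> u permutes {1..r + 1}"
    using permutes_compose[OF u1 coxeter_elt_permutes] by simp
  then show "v \<in> cube_interval r u"
    unfolding cube_interval_def using v u1 bnd by (auto intro!: bruhat_le_if_code_le)
qed

section \<open>Polyhedra with the face lattice of a cube\<close>

text \<open>
  Subtracting the value at the origin turns an affine form into a linear one.
\<close>

definition affine_form :: "('a::real_vector \<Rightarrow> real) \<Rightarrow> bool" where
  "affine_form f \<longleftrightarrow> linear (\<lambda>x. f x - f 0)"

lemma affine_form_combination:
  assumes "affine_form f"
  shows "f ((1 - c) *\<^sub>R x + c *\<^sub>R y) = (1 - c) * f x + c * f y"
proof -
  interpret linear "\<lambda>x. f x - f 0" using assms by (simp add: affine_form_def)
  show ?thesis using add[of "(1 - c) *\<^sub>R x" "c *\<^sub>R y"] scale[of "1 - c" x] scale[of c y]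
    by (simp add: algebra_simps)
qed

lemma affine_form_add:
  assumes "affine_form f" "affine_form g" shows "affine_form (\<lambda>x. f x + g x)"
  using linear_compose_add[OF assms[unfolded affine_form_def]]
  by (simp add: affine_form_def algebra_simps)

lemma affine_form_diff:
  assumes "affine_form f" "affine_form g" shows "affine_form (\<lambda>x. f x - g x)"
  using linear_compose_sub[OF assms[unfolded affine_form_def]]
  by (simp add: affine_form_def algebra_simps)

lemma affine_form_const: "affine_form (\<lambda>x. c)"
  by (simp add: affine_form_def module_hom_zero)

lemma affine_form_linear: "linear f \<Longrightarrow> affine_form f"
  by (simp add: affine_form_def linear_0)

lemma continuous_on_affine_form:
  fixes f :: "'a::euclidean_space \<Rightarrow> real"
  assumes "affine_form f" shows "continuous_on S f"
proof -
  have "continuous_on S (\<lambda>x. f x - f 0)"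
    using assms by (simp add: affine_form_def linear_continuous_on linear_conv_bounded_linear)
  from continuous_on_add[OF this continuous_on_const[of S "f 0"]] show ?thesis by simp
qed

text \<open>
  A polyhedron inside an affine subspace, cut out by pairs of opposite constraints \<open>0 \<le> lo i\<close> and
  \<open>0 \<le> up i\<close>.  Two constraints of a pair are never tight together, while every choice of at most one
  constraint from each pair is the exact set of tight constraints at some point of the polyhedron.  These two
  properties alone determine the face lattice.
\<close>

locale cube_system =
  fixes I :: "'i set" and A :: "'a::euclidean_space set" and lo up :: "'i \<Rightarrow> 'a \<Rightarrow> real"
  assumes fin: "finite I" and aff: "affine A"
    and aff_lo: "i \<in> I \<Longrightarrow> affine_form (lo i)" and aff_up: "i \<in> I \<Longrightarrow> affine_form (up i)"
    and separated: "\<lbrakk>t \<in> A; \<forall>i\<in>I. 0 \<le> lo i t \<and> 0 \<le> up i t; i \<in> I; lo i t = 0\<rbrakk> \<Longrightarrow> up i t \<noteq> 0"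
    and realised: "\<lbrakk>X \<subseteq> I; Y \<subseteq> I; X \<inter> Y = {}\<rbrakk> \<Longrightarrow> \<exists>t\<in>A. \<forall>i\<in>I. 0 \<le> lo i t \<and> 0 \<le> up i t \<and>
      (lo i t = 0 \<longleftrightarrow> i \<in> X) \<and> (up i t = 0 \<longleftrightarrow> i \<in> Y)"
begin

definition body :: "'a set" where
  "body = {t \<in> A. \<forall>i\<in>I. 0 \<le> lo i t \<and> 0 \<le> up i t}"

definition face :: "'i set \<Rightarrow> 'i set \<Rightarrow> 'a set" where
  "face X Y = {t \<in> body. (\<forall>i\<in>X. lo i t = 0) \<and> (\<forall>i\<in>Y. up i t = 0)}"

lemma realised_face:
  assumes "X \<subseteq> I" "Y \<subseteq> I" "X \<inter> Y = {}"
  obtains t where "t \<in> face X Y" "\<And>i. i \<in> I \<Longrightarrow> lo i t = 0 \<longleftrightarrow> i \<in> X" "\<And>i. i \<in> I \<Longrightarrow> up i t = 0 \<longleftrightarrow> i \<in> Y"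
proof -
  obtain t where t: "t\<in>A" "\<forall>i\<in>I. 0 \<le> lo i t \<and> 0 \<le> up i t \<and>
      (lo i t = 0 \<longleftrightarrow> i \<in> X) \<and> (up i t = 0 \<longleftrightarrow> i \<in> Y)"
    using realised[OF assms] by blast
  show ?thesis using t assms by (intro that[of t]) (auto simp: face_def body_def)
qed

text \<open>
  A point at which exactly the constraints in \<open>X\<close> and \<open>Y\<close> are tight witnesses all inclusions.
\<close>

lemma face_subset_iff:
  assumes "X \<subseteq> I" "Y \<subseteq> I" "X \<inter> Y = {}" "X' \<subseteq> I" "Y' \<subseteq> I"
  shows "face X Y \<subseteq> face X' Y' \<longleftrightarrow> X' \<subseteq> X \<and> Y' \<subseteq> Y"
proof
  assume sub: "face X Y \<subseteq> face X' Y'"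
  obtain t where t: "t \<in> face X Y" "\<And>i. i \<in> I \<Longrightarrow> lo i t = 0 \<longleftrightarrow> i \<in> X" "\<And>i. i \<in> I \<Longrightarrow> up i t = 0 \<longleftrightarrow> i \<in> Y"
    using realised_face[OF assms(1-3)] by blast
  then have "t \<in> face X' Y'" using sub by blast
  then show "X' \<subseteq> X \<and> Y' \<subseteq> Y" using t assms(4,5) unfolding face_def by blast
qed (auto simp: face_def)

lemma face_eq_iff:
  assumes "X \<subseteq> I" "Y \<subseteq> I" "X \<inter> Y = {}" "X' \<subseteq> I" "Y' \<subseteq> I" "X' \<inter> Y' = {}"
  shows "face X Y = face X' Y' \<longleftrightarrow> X = X' \<and> Y = Y'"
  unfolding set_eq_subset using face_subset_iff[of X Y X' Y'] face_subset_iff[of X' Y' X Y] assms by auto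

lemma face_nonempty: "\<lbrakk>X \<subseteq> I; Y \<subseteq> I; X \<inter> Y = {}\<rbrakk> \<Longrightarrow> face X Y \<noteq> {}"
  by (metis emptyE realised_face)

lemma body_eq_face: "body = face {} {}"
  by (auto simp: face_def)

lemma convex_face: assumes "X \<subseteq> I" "Y \<subseteq> I" shows "convex (face X Y)"
  unfolding convex_alt
proof (intro ballI allI impI)
  fix x y and c :: real assume x: "x \<in> face X Y" and y: "y \<in> face X Y" and c: "0 \<le> c \<and> c \<le> 1"
  let ?z = "(1 - c) *\<^sub>R x + c *\<^sub>R y"
  have "?z \<in> A" using x y aff c by (auto simp: face_def body_def affine_def)
  moreover have "lo i ?z = (1 - c) * lo i x + c * lo i y" "up i ?z = (1 - c) * up i x + c * up i y"
    if "i \<in> I" for i using that affine_form_combination aff_lo aff_up by blast+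
  ultimately show "?z \<in> face X Y" using x y c assms
    by (auto simp: face_def body_def subset_iff)
qed

lemma convex_body: "convex body"
  using convex_face[of "{}" "{}"] by (simp add: body_eq_face)

lemma face_face_of: assumes "X \<subseteq> I" "Y \<subseteq> I" shows "face X Y face_of body"
  unfolding face_of_def
proof (intro conjI ballI impI)
  show "face X Y \<subseteq> body" by (auto simp: face_def)
  show "convex (face X Y)" by (rule convex_face[OF assms])
next
  have pos: "f a = 0 \<and> f b = 0" if f: "affine_form f" "0 \<le> f a" "0 \<le> f b" "f x = 0" "x \<in> open_segment a b"
    for f a b x
  proof -
    obtain c where c: "0 < c" "c < 1" "x = (1 - c) *\<^sub>R a + c *\<^sub>R b"
      using f(5) by (auto simp: in_segment)
    then have "(1 - c) * f a + c * f b = 0"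
      using affine_form_combination[OF f(1), of c a b] f(4) by simp
    moreover have "0 \<le> (1 - c) * f a" "0 \<le> c * f b" using f c by auto
    ultimately have "(1 - c) * f a = 0" "c * f b = 0" by linarith+
    then show ?thesis using c by auto
  qed
  fix a b x assume ab: "a \<in> body" "b \<in> body" and x: "x \<in> face X Y" "x \<in> open_segment a b"
  have "lo i a = 0 \<and> lo i b = 0" if "i \<in> X" for i
    using that assms ab x by (intro pos[of "lo i" _ _ x]) (auto simp: body_def face_def aff_lo subset_iff)
  moreover have "up i a = 0 \<and> up i b = 0" if "i \<in> Y" for i
    using that assms ab x by (intro pos[of "up i" _ _ x]) (auto simp: body_def face_def aff_up subset_iff)
  ultimately show "a \<in> face X Y" "b \<in> face X Y" using ab by (auto simp: face_def)
qed

text \<open>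
  Every nonempty face is cut out by the constraints that are tight at one of its relative interior points:
  the face defined by these constraints contains \<open>F\<close> because it meets the relative interior of \<open>F\<close>,
  and it is contained in \<open>F\<close> because each of its points lies on a segment of the body passing through that point.
\<close>

lemma faceE:
  assumes F: "F face_of body" "F \<noteq> {}"
  obtains X Y where "X \<subseteq> I" "Y \<subseteq> I" "X \<inter> Y = {}" "F = face X Y"
proof -
  have "convex F" using F face_of_imp_convex by blast
  then obtain z where z: "z \<in> rel_interior F" using F(2) rel_interior_eq_empty by blast
  then have zF: "z \<in> F" using rel_interior_subset by blast
  have FB: "F \<subseteq> body" using F(1) face_of_imp_subset by blast
  have zB: "z \<in> body" using zF FB by blast
  define X where "X = {i\<in>I. lo i z = 0}"
  define Y where "Y = {i\<in>I. up i z = 0}"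
  have XY: "X \<subseteq> I" "Y \<subseteq> I" "X \<inter> Y = {}"
    using zB separated[of z] by (auto simp: X_def Y_def body_def)
  have zf: "z \<in> face X Y" using zB by (auto simp: face_def X_def Y_def)
  have "F \<subseteq> face X Y"
    using subset_of_face_of[OF face_face_of[OF XY(1,2)] FB] z zf by blast
  moreover have "face X Y \<subseteq> F"
  proof
    fix y assume y: "y \<in> face X Y"
    then have yB: "y \<in> body" by (auto simp: face_def)
    show "y \<in> F"
    proof (cases "y = z")
      case False
      \<comment> \<open>Every form vanishing at \<open>z\<close> vanishes at \<open>y\<close>, so the segment from \<open>y\<close> can be prolonged a little beyond \<open>z\<close> inside the body.\<close>
      define p where "p d = (1 - (-d)) *\<^sub>R z + (-d) *\<^sub>R y" for d :: real
      have ev: "\<forall>\<^sub>F d in at_right 0. 0 \<le> f (p d)"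
        if f: "affine_form f" "0 \<le> f z" "f z = 0 \<longrightarrow> f y = 0" for f
      proof -
        have eq: "f (p d) = f z + d * (f z - f y)" for d
          unfolding p_def affine_form_combination[OF f(1)] by (simp add: algebra_simps)
        show ?thesis
        proof (cases "f z = 0")
          case True then show ?thesis using f eq by simp
        next
          case False
          then have "0 < f z" using f(2) by simp
          moreover have "((\<lambda>d. f z + d * (f z - f y)) \<longlongrightarrow> f z + 0 * (f z - f y)) (at_right 0)"
            by (intro tendsto_intros)
          ultimately have "\<forall>\<^sub>F d in at_right 0. 0 < f z + d * (f z - f y)"
            using order_tendstoD(1)[of _ "f z" "at_right 0" 0] by simp
          then show ?thesis by eventually_elim (simp add: eq)
        qed
      qed
      have "\<forall>\<^sub>F d in at_right 0. \<forall>i\<in>I. 0 \<le> lo i (p d) \<and> 0 \<le> up i (p d)"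
        using y zB by (intro eventually_ball_finite[OF fin] ballI eventually_conj ev)
          (auto simp: aff_lo aff_up body_def face_def X_def Y_def)
      moreover have "\<forall>\<^sub>F d in at_right (0::real). 0 < d"
        by (simp add: eventually_at_right_less)
      ultimately have "\<forall>\<^sub>F d in at_right 0. 0 < d \<and> (\<forall>i\<in>I. 0 \<le> lo i (p d) \<and> 0 \<le> up i (p d))"
        by eventually_elim simp
      then obtain d where d: "0 < d" "\<forall>i\<in>I. 0 \<le> lo i (p d) \<and> 0 \<le> up i (p d)"
        using eventually_happens' trivial_limit_at_right_real by blast
      have "p d \<in> A" using aff zB yB mem_affine[of A z y "1-(-d)" "-d"] by (simp add: p_def body_def)
      then have pB: "p d \<in> body" using d by (simp add: body_def)
      have "z = (1 - 1/(1+d)) *\<^sub>R y + (1/(1+d)) *\<^sub>R p d"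
      proof -
        have "(1+d) *\<^sub>R ((1 - 1/(1+d)) *\<^sub>R y + (1/(1+d)) *\<^sub>R p d) = (1+d) *\<^sub>R z"
          using d(1) by (simp add: p_def scaleR_add_right field_simps)
        then show ?thesis using d(1) by simp
      qed
      moreover have "y \<noteq> p d"
      proof
        assume "y = p d"
        then have "(1+d) *\<^sub>R y = (1+d) *\<^sub>R z" by (simp add: p_def algebra_simps)
        then show False using d False by simp
      qed
      ultimately have "z \<in> open_segment y (p d)"
        unfolding in_segment using d(1) by (intro conjI exI[of _ "1/(1+d)"]) auto
      then show ?thesis using F(1) yB pB zF unfolding face_of_def by blast
    qed (use zF in simp)
  qed
  ultimately show ?thesis using that XY by blast
qed

text \<open>
  Facets are the maximal proper faces, so they impose a single constraint.
\<close>

lemma facet_of_body_iff: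
  assumes "polyhedron body"
  shows "F facet_of body \<longleftrightarrow> (\<exists>i\<in>I. F = face {i} {} \<or> F = face {} {i})"
proof -
  have facet: "G facet_of body" if GX: "X \<union> Y = {i}" "X \<inter> Y = {}" "i \<in> I" "G = face X Y" for G X Y i
  proof -
    have XY: "X \<subseteq> I" "Y \<subseteq> I" using GX by auto
    have "G \<noteq> body"
      using GX XY face_eq_iff[of X Y "{}" "{}"] by (auto simp: body_eq_face)
    then obtain H where H: "H facet_of body" "G \<subseteq> H"
      using face_of_polyhedron_subset_facet[OF assms, of G] face_face_of[OF XY] face_nonempty[OF XY GX(2)]
        GX(4) by metis
    have "H face_of body" "H \<noteq> {}" "H \<noteq> body"
      using H(1) by (auto simp: facet_of_def)
    then obtain X' Y' where X': "X' \<subseteq> I" "Y' \<subseteq> I" "X' \<inter> Y' = {}" "H = face X' Y'"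
      using faceE by metis
    then have "X' \<subseteq> X \<and> Y' \<subseteq> Y" using H(2) GX XY X' face_subset_iff[of X Y X' Y'] by simp
    moreover have "X' \<noteq> {} \<or> Y' \<noteq> {}" using X' \<open>H \<noteq> body\<close> by (auto simp: body_eq_face)
    moreover have "X = {i} \<and> Y = {} \<or> X = {} \<and> Y = {i}"
      using GX(1,2) unfolding Un_singleton_iff by auto
    ultimately have "X' = X \<and> Y' = Y"
      by (elim disjE conjE) (simp_all add: subset_singleton_iff)
    then have "H = G" using X'(4) GX(4) by simp
    then show ?thesis using H(1) by simp
  qed
  show ?thesis
  proof
    assume F: "F facet_of body"
    then have "F face_of body" "F \<noteq> {}" "F \<noteq> body" by (auto simp: facet_of_def)
    then obtain X Y where XY: "X \<subseteq> I" "Y \<subseteq> I" "X \<inter> Y = {}" "F = face X Y"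
      using faceE by metis
    have "X \<noteq> {} \<or> Y \<noteq> {}" using \<open>F \<noteq> body\<close> XY(4) body_eq_face by metis
    then obtain i where i: "i \<in> X \<or> i \<in> Y" by blast
    have eq: "F = G" if G: "G facet_of body" "F \<subseteq> G" for G
    proof (rule ccontr)
      assume "F \<noteq> G"
      have "G face_of body" using G by (simp add: facet_of_def)
      then have "convex G" by (rule face_of_imp_convex)
      moreover have "F face_of G"
        using face_of_subset[OF \<open>F face_of body\<close> G(2)] face_of_imp_subset[OF \<open>G face_of body\<close>] .
      ultimately have "aff_dim F < aff_dim G" using \<open>F \<noteq> G\<close> by (rule face_of_aff_dim_lt)
      then show False using F G by (simp add: facet_of_def)
    qed
    show "\<exists>i\<in>I. F = face {i} {} \<or> F = face {} {i}"
    proof (cases "i \<in> X")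
      case True
      then have iI: "i \<in> I" using XY(1) by blast
      have "F \<subseteq> face {i} {}" using XY(4) True by (auto simp: face_def)
      then have "F = face {i} {}" using facet[of "{i}" "{}" i] iI by (intro eq) auto
      then show ?thesis using iI by metis
    next
      case False
      then have iI: "i \<in> I" using XY(2) i by blast
      have "F \<subseteq> face {} {i}" using XY(4) False i by (auto simp: face_def)
      then have "F = face {} {i}" using facet[of "{}" "{i}" i] iI by (intro eq) auto
      then show ?thesis using iI by metis
    qed
  next
    assume "\<exists>i\<in>I. F = face {i} {} \<or> F = face {} {i}"
    then obtain i where "i \<in> I" "F = face {i} {} \<or> F = face {} {i}" by blast
    then show "F facet_of body" using facet[of "{i}" "{}" i F] facet[of "{}" "{i}" i F] by auto
  qed
qed

text \<open>
  A face leaving the pair \<open>i\<close> free strictly contains a nonempty face with one more tight constraint,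
  so it is not a single point.
\<close>

lemma extreme_point_tight:
  assumes "z extreme_point_of body" "i \<in> I" "lo i z \<noteq> 0" shows "up i z = 0"
proof (rule ccontr)
  assume up: "up i z \<noteq> 0"
  have "{z} face_of body" using assms by (simp add: face_of_singleton)
  then obtain X Y where XY: "X \<subseteq> I" "Y \<subseteq> I" "X \<inter> Y = {}" "{z} = face X Y"
    using faceE by (metis insert_not_empty)
  have z: "z \<in> face X Y" using XY by auto
  then have i: "i \<notin> X" "i \<notin> Y" using assms(3) up by (auto simp: face_def)
  have "face (insert i X) Y \<subseteq> {z}" using XY by (auto simp: face_def)
  moreover have "face (insert i X) Y \<noteq> {}" using XY i assms by (intro face_nonempty) auto
  ultimately have "z \<in> face (insert i X) Y" by blast
  then show False using assms(3) by (simp add: face_def)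
qed

lemma closed_body: assumes "closed A" shows "closed body"
proof -
  have "body = A \<inter> (\<Inter>i\<in>I. {t. 0 \<le> lo i t} \<inter> {t. 0 \<le> up i t})" by (auto simp: body_def)
  moreover have "closed {t. 0 \<le> lo i t}" "closed {t. 0 \<le> up i t}" if "i \<in> I" for i
    using that by (auto intro!: closed_Collect_le continuous_on_affine_form aff_lo aff_up affine_form_const)
  ultimately show ?thesis using assms by (auto intro!: closed_Int closed_INT)
qed

text \<open>
  The index \<open>None\<close> stands for the empty face.
\<close>

definition patterns :: "('i set \<times> 'i set) option set" where
  "patterns = insert None (Some ` {(X, Y). X \<subseteq> I \<and> Y \<subseteq> I \<and> X \<inter> Y = {}})"

definition pattern_face :: "('i set \<times> 'i set) option \<Rightarrow> 'a set" where
  "pattern_face p = (case p of None \<Rightarrow> {} | Some (X, Y) \<Rightarrow> face X Y)"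

lemma pattern_cases:
  assumes "p \<in> patterns"
  obtains "p = None" "pattern_face p = {}"
  | X Y where "p = Some (X, Y)" "X \<subseteq> I" "Y \<subseteq> I" "X \<inter> Y = {}" "pattern_face p = face X Y" "face X Y \<noteq> {}"
proof (cases p)
  case None
  then show ?thesis using that(1) by (simp add: pattern_face_def)
next
  case (Some XY)
  then obtain X Y where "p = Some (X, Y)" by (cases XY) auto
  then show ?thesis using assms that(2)[of X Y] face_nonempty[of X Y]
    by (auto simp: patterns_def pattern_face_def)
qed

lemma pattern_face_subset_iff:
  assumes "p \<in> patterns" "q \<in> patterns"
  shows "pattern_face p \<subseteq> pattern_face q \<longleftrightarrow> (case p of None \<Rightarrow> True | Some (X, Y) \<Rightarrow>
    (case q of None \<Rightarrow> False | Some (X', Y') \<Rightarrow> X' \<subseteq> X \<and> Y' \<subseteq> Y))"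
  using assms(1)
proof (cases rule: pattern_cases)
  case (2 X Y)
  from assms(2) show ?thesis
    by (cases rule: pattern_cases) (use 2 in \<open>auto simp: face_subset_iff\<close>)
qed simp

lemma pattern_face_bij: "bij_betw pattern_face patterns {F. F face_of body}"
  unfolding bij_betw_def
proof (intro conjI equalityI subsetI)
  show "inj_on pattern_face patterns"
  proof (rule inj_onI)
    fix p q assume "p \<in> patterns" "q \<in> patterns" and eq: "pattern_face p = pattern_face q"
    then show "p = q"
      by (elim pattern_cases) (simp_all add: face_eq_iff)
  qed
next
  fix F assume "F \<in> pattern_face ` patterns"
  then obtain p where "p \<in> patterns" "F = pattern_face p" by blast
  then show "F \<in> {F. F face_of body}"
    by (elim pattern_cases) (simp_all add: face_face_of)
next
  fix F assume "F \<in> {F. F face_of body}"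
  then have F: "F face_of body" by simp
  show "F \<in> pattern_face ` patterns"
  proof (cases "F = {}")
    case True
    then have "F = pattern_face None" "None \<in> patterns" by (auto simp: pattern_face_def patterns_def)
    then show ?thesis by blast
  next
    case False
    obtain X Y where XY: "X \<subseteq> I" "Y \<subseteq> I" "X \<inter> Y = {}" "F = face X Y" using faceE[OF F False] .
    then have "F = pattern_face (Some (X, Y))" "Some (X, Y) \<in> patterns"
      by (auto simp: pattern_face_def patterns_def)
    then show ?thesis by blast
  qed
qed

end

text \<open>
  Inclusion of faces is expressed by the patterns of tight constraints alone, so matching equal patterns is an
  isomorphism between the face lattices of any two systems over the same index set.
\<close>

lemma cube_systems_face_lattice_iso:
  assumes "cube_system I A lo up" "cube_system I A' lo' up'"
  shows "face_lattice_iso (cube_system.body I A lo up) (cube_system.body I A' lo' up')"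
proof -
  interpret P: cube_system I A lo up by fact
  interpret Q: cube_system I A' lo' up' by fact
  let ?g = P.pattern_face and ?h = Q.pattern_face
  let ?phi = "?h \<circ> inv_into P.patterns ?g"
  have ord: "?h p \<subseteq> ?h q \<longleftrightarrow> ?g p \<subseteq> ?g q" if p: "p \<in> P.patterns" and q: "q \<in> P.patterns" for p q
    using P.pattern_face_subset_iff[of p q] Q.pattern_face_subset_iff[of p q] p q by simp
  have inv: "bij_betw (inv_into P.patterns ?g) {F. F face_of P.body} P.patterns"
    by (rule bij_betw_inv_into[OF P.pattern_face_bij])
  have "?phi F \<subseteq> ?phi F' \<longleftrightarrow> F \<subseteq> F'" if "F face_of P.body" "F' face_of P.body" for F F'
  proof -
    have "inv_into P.patterns ?g F \<in> P.patterns" "inv_into P.patterns ?g F' \<in> P.patterns"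
      using inv that by (auto simp: bij_betw_def)
    moreover have "?g (inv_into P.patterns ?g F) = F" "?g (inv_into P.patterns ?g F') = F'"
      using P.pattern_face_bij that by (simp_all add: bij_betw_inv_into_right)
    ultimately show ?thesis using ord by simp
  qed
  moreover have "bij_betw ?phi {F. F face_of P.body} {F. F face_of Q.body}"
    using bij_betw_trans[OF inv Q.pattern_face_bij] .
  ultimately show ?thesis unfolding face_lattice_iso_def by blast
qed

lemma cube_system_standard_cube:
  fixes \<beta> :: "'i \<Rightarrow> 'a::euclidean_space"
  assumes fin: "finite I" and \<beta>: "inj_on \<beta> I" "\<beta> ` I \<subseteq> Basis"
  defines "A \<equiv> {t. \<forall>b\<in>Basis - \<beta> ` I. t \<bullet> b = 0}"
  shows "cube_system I A (\<lambda>i t. t \<bullet> \<beta> i) (\<lambda>i t. 1 - t \<bullet> \<beta> i)"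
    and "cube_system.body I A (\<lambda>i t. t \<bullet> \<beta> i) (\<lambda>i t. 1 - t \<bullet> \<beta> i) = cbox 0 (\<Sum>(\<beta> ` I))"
proof -
  have inner: "linear (\<lambda>t::'a. t \<bullet> b)" for b
    by (simp add: linear_iff inner_add_left)
  have up: "affine_form (\<lambda>t::'a. 1 - t \<bullet> b)" for b
    using affine_form_diff[OF affine_form_const affine_form_linear[OF inner]] .
  show sys: "cube_system I A (\<lambda>i t. t \<bullet> \<beta> i) (\<lambda>i t. 1 - t \<bullet> \<beta> i)"
  proof
    show "affine A" unfolding affine_def A_def by (auto simp: inner_add_left)
    fix X Y assume XY: "X \<subseteq> I" "Y \<subseteq> I" "X \<inter> Y = {}"
    define c where "c i = (if i \<in> X then 0 else if i \<in> Y then 1 else 1/2 :: real)" for i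
    define t where "t = (\<Sum>i\<in>I. c i *\<^sub>R \<beta> i)"
    have tb: "t \<bullet> \<beta> i = c i" if "i \<in> I" for i
    proof -
      have "t \<bullet> \<beta> i = (\<Sum>j\<in>I. c j * (\<beta> j \<bullet> \<beta> i))" by (simp add: t_def inner_sum_left)
      also have "\<dots> = (\<Sum>j\<in>I. if j = i then c i else 0)"
        using \<beta> that by (intro sum.cong) (auto simp: inner_Basis inj_on_def image_subset_iff)
      finally show ?thesis using that fin by simp
    qed
    have "t \<bullet> b = 0" if "b \<in> Basis - \<beta> ` I" for b
      unfolding t_def inner_sum_left using that \<beta>
      by (intro sum.neutral) (auto simp: inner_Basis image_subset_iff)
    then have "t \<in> A" by (auto simp: A_def)
    then show "\<exists>t\<in>A. \<forall>i\<in>I. 0 \<le> t \<bullet> \<beta> i \<and> 0 \<le> 1 - t \<bullet> \<beta> i \<and>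
           (t \<bullet> \<beta> i = 0) = (i \<in> X) \<and> (1 - t \<bullet> \<beta> i = 0) = (i \<in> Y)"
      using XY tb by (intro bexI[of _ t]) (auto simp: c_def)
  qed (auto simp: fin intro: up affine_form_linear inner)
  have sum: "\<Sum>(\<beta> ` I) \<bullet> b = (if b \<in> \<beta> ` I then 1 else 0)" if "b \<in> Basis" for b
  proof -
    have "\<Sum>(\<beta> ` I) \<bullet> b = (\<Sum>x\<in>\<beta> ` I. x \<bullet> b)" by (simp add: inner_sum_left)
    also have "\<dots> = (\<Sum>x\<in>\<beta> ` I. if x = b then 1 else 0)"
      using \<beta> that by (intro sum.cong) (auto simp: inner_Basis image_subset_iff)
    finally show ?thesis using fin by simp
  qed
  interpret cube_system I A "\<lambda>i t. t \<bullet> \<beta> i" "\<lambda>i t. 1 - t \<bullet> \<beta> i" by (rule sys)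
  have "t \<in> body \<longleftrightarrow> t \<in> cbox 0 (\<Sum>(\<beta> ` I))" for t
  proof -
    have "t \<in> cbox 0 (\<Sum>(\<beta> ` I)) \<longleftrightarrow> (\<forall>b\<in>Basis. 0 \<le> t \<bullet> b \<and> t \<bullet> b \<le> (if b \<in> \<beta> ` I then 1 else 0))"
      by (auto simp: mem_box sum)
    also have "\<dots> \<longleftrightarrow> (\<forall>b\<in>Basis - \<beta> ` I. t \<bullet> b = 0) \<and> (\<forall>b\<in>\<beta> ` I. 0 \<le> t \<bullet> b \<and> t \<bullet> b \<le> 1)"
      using \<beta>(2) by (force split: if_splits)
    finally show ?thesis by (simp add: body_def) (auto simp: A_def)
  qed
  then show "body = cbox 0 (\<Sum>(\<beta> ` I))" by blast
qed

section \<open>The merging process\<close>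

text \<open>
  Slot \<open>k\<close> of a decreasing sequence \<open>x\<close> is the gap between \<open>x k\<close> and \<open>x (k + 1)\<close>.  These entries are replaced by one that,
  together with the removed number \<open>s\<close>, has the same sum.  If \<open>s\<close> lies between the two entries, so does
  the new one, and the sequence stays decreasing.
\<close>

definition merge :: "nat \<Rightarrow> real \<Rightarrow> (nat \<Rightarrow> real) \<Rightarrow> nat \<Rightarrow> real" where
  "merge k s x j = (if j < k then x j else if j = k then x k + x (Suc k) - s else x (Suc j))"

text \<open>
  The sequence after the coordinates \<open>T 1, ..., T m\<close> have been removed, \<open>T i\<close> being merged into slot \<open>k i\<close>.
  It starts with \<open>lam 1, ..., lam (r + 1)\<close>; only the first \<open>r + 1 - m\<close> entries are meaningful.
\<close>

primrec state :: "(nat \<Rightarrow> real) \<Rightarrow> (nat \<Rightarrow> nat) \<Rightarrow> (nat \<Rightarrow> real) \<Rightarrow> nat \<Rightarrow> nat \<Rightarrow> real" where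
  "state lam k T 0 = (\<lambda>j. lam (Suc j))"
| "state lam k T (Suc m) = merge (k (Suc m)) (T (Suc m)) (state lam k T m)"

definition lower_slack :: "(nat \<Rightarrow> real) \<Rightarrow> (nat \<Rightarrow> nat) \<Rightarrow> nat \<Rightarrow> (nat \<Rightarrow> real) \<Rightarrow> real" where
  "lower_slack lam k m T = T (Suc m) - state lam k T m (Suc (k (Suc m)))"

definition upper_slack :: "(nat \<Rightarrow> real) \<Rightarrow> (nat \<Rightarrow> nat) \<Rightarrow> nat \<Rightarrow> (nat \<Rightarrow> real) \<Rightarrow> real" where
  "upper_slack lam k m T = state lam k T m (k (Suc m)) - T (Suc m)"

definition feasible :: "(nat \<Rightarrow> real) \<Rightarrow> (nat \<Rightarrow> nat) \<Rightarrow> (nat \<Rightarrow> real) \<Rightarrow> nat \<Rightarrow> bool" where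
  "feasible lam k T M \<longleftrightarrow> (\<forall>m<M. 0 \<le> lower_slack lam k m T \<and> 0 \<le> upper_slack lam k m T)"

text \<open>
  The step that removes \<open>T (Suc m)\<close> needs the entries with indices \<open>k (Suc m)\<close> and \<open>k (Suc m) + 1\<close> to be among the
  \<open>r + 1 - m\<close> meaningful ones.
\<close>

definition valid_slots :: "nat \<Rightarrow> (nat \<Rightarrow> nat) \<Rightarrow> bool" where
  "valid_slots r k \<longleftrightarrow> (\<forall>m<r. k (Suc m) + m < r)"

lemma valid_slotsD: "valid_slots r k \<Longrightarrow> m < r \<Longrightarrow> k (Suc m) + m < r"
  by (simp add: valid_slots_def)

lemma valid_slots_le: "valid_slots r k \<Longrightarrow> i \<in> {1..r} \<Longrightarrow> k i + i \<le> r"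
  using valid_slotsD[of r k "i - 1"] by (cases i) auto

lemma feasibleD:
  assumes "feasible lam k T M" "m < M"
  shows "state lam k T m (Suc (k (Suc m))) \<le> T (Suc m)" "T (Suc m) \<le> state lam k T m (k (Suc m))"
  using assms by (auto simp: feasible_def lower_slack_def upper_slack_def)

lemma feasible_mono: "feasible lam k T M \<Longrightarrow> N \<le> M \<Longrightarrow> feasible lam k T N"
  by (auto simp: feasible_def)

lemma feasible_Suc: "feasible lam k T (Suc M) \<longleftrightarrow>
    feasible lam k T M \<and> 0 \<le> lower_slack lam k M T \<and> 0 \<le> upper_slack lam k M T"
  by (auto simp: feasible_def less_Suc_eq)

lemma state_cong:
  assumes "\<And>i. 1 \<le> i \<Longrightarrow> i \<le> m \<Longrightarrow> k i = k' i" "\<And>i. 1 \<le> i \<Longrightarrow> i \<le> m \<Longrightarrow> T i = T' i"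
  shows "state lam k T m = state lam k' T' m"
  using assms by (induction m) auto

lemma slack_cong:
  assumes "\<And>i. 1 \<le> i \<Longrightarrow> i \<le> Suc m \<Longrightarrow> k i = k' i" "\<And>i. 1 \<le> i \<Longrightarrow> i \<le> Suc m \<Longrightarrow> T i = T' i"
  shows "lower_slack lam k m T = lower_slack lam k' m T'" "upper_slack lam k m T = upper_slack lam k' m T'"
proof -
  have "state lam k T m = state lam k' T' m" using assms by (intro state_cong) auto
  then show "lower_slack lam k m T = lower_slack lam k' m T'" "upper_slack lam k m T = upper_slack lam k' m T'"
    using assms by (simp_all add: lower_slack_def upper_slack_def)
qed

lemma sum_merge:
  "sum (merge k s x) {..<L} = (if L \<le> k then sum x {..<L} else sum x {..<Suc L} - s)"
proof (induction L)
  case (Suc L)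
  consider "Suc L \<le> k" | "L = k" | "k < L" by linarith
  then show ?case using Suc by cases (auto simp: merge_def)
qed simp

lemma merge_at_end:
  assumes "s = x c" "c = k \<or> c = Suc k"
  shows "merge k s x j = (if j < c then x j else x (Suc j))"
  using assms by (auto simp: merge_def)

lemma state_strictly_decreasing:
  assumes lam: "\<forall>i\<in>{1..r}. lam i > lam (i + 1)" and k: "valid_slots r k"
    and "feasible lam k T M" "M \<le> r" "j + M < r"
  shows "state lam k T M (Suc j) < state lam k T M j"
  using assms(3-)
proof (induction M arbitrary: j)
  case 0
  then show ?case using lam by auto
next
  case (Suc M)
  let ?x = "state lam k T M" and ?k = "k (Suc M)"
  have feas: "feasible lam k T M" using Suc.prems by (simp add: feasible_Suc)
  have x: "?x (Suc i) < ?x i" if "i + M < r" for i using Suc.IH[OF feas] Suc.prems that by simp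
  have s: "?x (Suc ?k) \<le> T (Suc M)" "T (Suc M) \<le> ?x ?k" using feasibleD[OF Suc.prems(1)] by auto
  have kM: "?k + M < r" using k Suc.prems by (simp add: valid_slotsD)
  consider "Suc j < ?k" | "Suc j = ?k" | "j = ?k" | "?k < j" by linarith
  then show ?case
  proof cases
    case 2
    then show ?thesis using x[of j] x[of "?k"] s kM Suc.prems by (auto simp: merge_def)
  next
    case 3
    then show ?thesis using x[of "Suc j"] s Suc.prems by (auto simp: merge_def)
  qed (use x[of j] x[of "Suc j"] Suc.prems in \<open>auto simp: merge_def\<close>)
qed

lemma state_bounds:
  assumes lam: "\<forall>i\<in>{1..r}. lam i > lam (i + 1)" and k: "valid_slots r k"
    and "feasible lam k T M" "M \<le> r" "j + M \<le> r"
  shows "lam (r + 1) \<le> state lam k T M j \<and> state lam k T M j \<le> lam 1"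
  using assms(3-)
proof (induction M arbitrary: j)
  case 0
  have "lam 1 \<ge> lam (Suc j) \<and> lam (Suc j) \<ge> lam (r + 1)" if "j \<le> r" for j
  proof
    show "lam 1 \<ge> lam (Suc j)" using that
    proof (induction j)
      case (Suc j) then show ?case using bspec[OF lam, of "Suc j"] by simp
    qed simp
    show "lam (Suc j) \<ge> lam (r + 1)" using that
    proof (induction rule: inc_induct)
      case (step n) then show ?case using bspec[OF lam, of "Suc n"] by simp
    qed simp
  qed
  then show ?case using 0 by simp
next
  case (Suc M)
  let ?x = "state lam k T M" and ?k = "k (Suc M)"
  have feas: "feasible lam k T M" using Suc.prems by (simp add: feasible_Suc)
  have x: "lam (r + 1) \<le> ?x i \<and> ?x i \<le> lam 1" if "i + M \<le> r" for i using Suc.IH[OF feas] Suc.prems that by simp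
  have s: "?x (Suc ?k) \<le> T (Suc M)" "T (Suc M) \<le> ?x ?k" using feasibleD[OF Suc.prems(1)] by auto
  have kM: "?k + M < r" using k Suc.prems by (simp add: valid_slotsD)
  show ?case using x[of j] x[of "Suc j"] x[of ?k] x[of "Suc ?k"] s kM Suc.prems
    by (auto simp: merge_def)
qed

lemma state_sum:
  assumes k: "valid_slots r k" and "M \<le> r"
  shows "(\<Sum>j<r + 1 - M. state lam k T M j) = (\<Sum>i = 1..r + 1. lam i) - (\<Sum>i = 1..M. T i)"
  using assms(2)
proof (induction M)
  case 0
  have "(\<Sum>j<r + 1. lam (Suc j)) = (\<Sum>i = 1..r + 1. lam i)"
    by (rule sum.reindex_bij_witness[of _ "\<lambda>i. i - 1" Suc]) auto
  then show ?case by simp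
next
  case (Suc M)
  have "k (Suc M) + M < r" using k Suc.prems by (simp add: valid_slotsD)
  then have "\<not> r + 1 - Suc M \<le> k (Suc M)" "Suc (r + 1 - Suc M) = r + 1 - M" by auto
  then have "(\<Sum>j<r + 1 - Suc M. state lam k T (Suc M) j) = (\<Sum>j<r + 1 - M. state lam k T M j) - T (Suc M)"
    by (simp only: state.simps sum_merge if_False)
  then show ?case using Suc by simp
qed

lemma affine_form_state:
  assumes T: "\<And>i. affine_form (\<lambda>t. T t i)"
  shows "affine_form (\<lambda>t. state lam k (T t) m j)"
proof (induction m arbitrary: j)
  case 0
  show ?case by (simp add: affine_form_const)
next
  case (Suc m)
  consider "j < k (Suc m)" | "j = k (Suc m)" | "k (Suc m) < j" by linarith
  then show ?case
    by cases (use Suc T in \<open>simp_all add: merge_def affine_form_add affine_form_diff\<close>)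
qed

text \<open>
  In a strictly decreasing sequence a number lies in two different gaps only if the gaps are adjacent
  and the number is their common end.
\<close>

lemma slots_meet:
  fixes x :: "nat \<Rightarrow> real"
  assumes x: "\<And>i. i < N \<Longrightarrow> x (Suc i) < x i" and k: "k < N" "k' < N"
    and s: "x (Suc k) \<le> s" "s \<le> x k" and s': "x (Suc k') \<le> s" "s \<le> x k'"
  shows "k' = k \<or> k' = Suc k \<and> s = x (Suc k) \<or> k = Suc k' \<and> s = x k"
proof -
  have dec: "x j < x i" if "i < j" "j \<le> N" for i j
    using that
  proof (induction rule: strict_inc_induct)
    case (base i) then show ?case using x[of i] by simp
  next
    case (step i) then show ?case using x[of i] by simp
  qed
  show ?thesis
  proof (cases k k' rule: linorder_cases)
    case less
    have "\<not> Suc k < k'" using dec[of "Suc k" k'] s s' k by auto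
    then have "k' = Suc k" using less by simp
    then show ?thesis using s s' by simp
  next
    case greater
    have "\<not> Suc k' < k" using dec[of "Suc k'" k] s s' k by auto
    then have "k = Suc k'" using greater by simp
    then show ?thesis using s s' by simp
  qed simp
qed

text \<open>
  This is what makes the cells fit together: for a number equal to an entry of the sequence, merging with the left
  or with the right neighbour just deletes that entry, so both choices lead to the same sequence.
\<close>

lemma merge_tie:
  assumes "k' = k \<or> k' = Suc k \<and> s = x (Suc k) \<or> k = Suc k' \<and> s = x k"
  shows "merge k s x = merge k' s x"
  using assms by (auto simp: merge_def fun_eq_iff)

text \<open>
  A point feasible for two slot functions runs through the same sequences for both, so the two differ
  only where a tie occurs.
\<close>

lemma states_meet:
  assumes lam: "\<forall>i\<in>{1..r}. lam i > lam (i + 1)" and k: "valid_slots r k" "valid_slots r k'"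
    and f: "feasible lam k T r" "feasible lam k' T r" and "m < r"
  shows "k' (Suc m) = k (Suc m) \<or> k' (Suc m) = Suc (k (Suc m)) \<and> lower_slack lam k m T = 0
       \<or> k (Suc m) = Suc (k' (Suc m)) \<and> upper_slack lam k m T = 0"
proof -
  have tie: "k' (Suc m) = k (Suc m) \<or> k' (Suc m) = Suc (k (Suc m)) \<and> T (Suc m) = state lam k T m (Suc (k (Suc m)))
       \<or> k (Suc m) = Suc (k' (Suc m)) \<and> T (Suc m) = state lam k T m (k (Suc m))"
    if "m < r" "state lam k T m = state lam k' T m" for m
    using that k f
    by (intro slots_meet[where N = "r - m"] state_strictly_decreasing[OF lam])
      (auto simp: feasibleD feasible_mono dest!: valid_slotsD[where m = m] dest: feasibleD[where m = m])
  have "state lam k T m = state lam k' T m" if "m \<le> r" for m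
    using that
  proof (induction m)
    case (Suc m)
    then show ?case using tie[of m] by (auto intro: merge_tie)
  qed simp
  then show ?thesis using tie[OF \<open>m < r\<close>] \<open>m < r\<close> by (auto simp: lower_slack_def upper_slack_def)
qed

lemma feasible_transfer:
  assumes lam: "\<forall>i\<in>{1..r}. lam i > lam (i + 1)" and k: "valid_slots r k" "valid_slots r k'"
    and f: "feasible lam k T r"
    and tie: "\<And>m. m < r \<Longrightarrow> k' (Suc m) = k (Suc m) \<or> k' (Suc m) = Suc (k (Suc m)) \<and> lower_slack lam k m T = 0
       \<or> k (Suc m) = Suc (k' (Suc m)) \<and> upper_slack lam k m T = 0"
  shows "feasible lam k' T r"
proof -
  have st: "state lam k T m = state lam k' T m" if "m \<le> r" for m
    using that
  proof (induction m)
    case (Suc m)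
    then show ?case using tie[of m] by (auto intro!: merge_tie simp: lower_slack_def upper_slack_def)
  qed simp
  have "0 \<le> lower_slack lam k' m T \<and> 0 \<le> upper_slack lam k' m T" if m: "m < r" for m
  proof -
    have dec: "state lam k T m (Suc j) < state lam k T m j" if "j + m < r" for j
      using that m f k by (intro state_strictly_decreasing[OF lam]) (auto intro: feasible_mono)
    have "k (Suc m) + m < r" "k' (Suc m) + m < r" using k m by (auto simp: valid_slotsD)
    then show ?thesis
      using tie[OF m] feasibleD[OF f m] dec[of "k' (Suc m)"] st[of m] m
      by (auto simp: lower_slack_def upper_slack_def)
  qed
  then show ?thesis by (simp add: feasible_def)
qed

text \<open>
  Points of a cell are parametrised by the cube: the weight \<open>c m\<close> places the next coordinate between the two
  entries of its slot, the weights 0 and 1 giving the upper and the lower end.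
\<close>

primrec interpolated_state :: "(nat \<Rightarrow> real) \<Rightarrow> (nat \<Rightarrow> nat) \<Rightarrow> (nat \<Rightarrow> real) \<Rightarrow> nat \<Rightarrow> nat \<Rightarrow> real" where
  "interpolated_state lam k c 0 = (\<lambda>j. lam (Suc j))"
| "interpolated_state lam k c (Suc m) = merge (k (Suc m))
     ((1 - c m) * interpolated_state lam k c m (k (Suc m)) + c m * interpolated_state lam k c m (Suc (k (Suc m))))
     (interpolated_state lam k c m)"

text \<open>
  Choosing weights freely reaches all combinations of tight constraints, because the two ends of a slot are
  always distinct.
\<close>

lemma realise_slacks:
  assumes lam: "\<forall>i\<in>{1..r}. lam i > lam (i + 1)" and k: "valid_slots r k"
    and c: "\<And>m. 0 \<le> c m \<and> c m \<le> (1::real)"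
  obtains T where "(\<Sum>i = 1..r + 1. T i) = (\<Sum>i = 1..r + 1. lam i)" "feasible lam k T r"
    "\<And>m. m < r \<Longrightarrow> lower_slack lam k m T = 0 \<longleftrightarrow> c m = 1"
    "\<And>m. m < r \<Longrightarrow> upper_slack lam k m T = 0 \<longleftrightarrow> c m = 0"
proof -
  let ?y = "interpolated_state lam k c"
  \<comment> \<open>The last coordinate is the single entry left over at the end.\<close>
  define T where "T i = (if i = r + 1 then ?y r 0 else
    (1 - c (i - 1)) * ?y (i - 1) (k i) + c (i - 1) * ?y (i - 1) (Suc (k i)))" for i
  have st: "state lam k T m = ?y m" if "m \<le> r" for m
    using that by (induction m) (auto simp: T_def)
  have slack: "lower_slack lam k m T = (1 - c m) * (state lam k T m (k (Suc m)) - state lam k T m (Suc (k (Suc m))))"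
    "upper_slack lam k m T = c m * (state lam k T m (k (Suc m)) - state lam k T m (Suc (k (Suc m))))" if "m < r" for m
    using that st[of m] by (auto simp: lower_slack_def upper_slack_def T_def algebra_simps)
  have feas: "feasible lam k T M" if "M \<le> r" for M
    using that
  proof (induction M)
    case (Suc M)
    then have "state lam k T M (Suc (k (Suc M))) < state lam k T M (k (Suc M))"
      using k by (intro state_strictly_decreasing[OF lam k]) (auto simp: valid_slotsD)
    then show ?case using Suc slack[of M] c[of M] by (simp add: feasible_Suc)
  qed (simp add: feasible_def)
  have pos: "state lam k T m (Suc (k (Suc m))) < state lam k T m (k (Suc m))" if "m < r" for m
    using that k feas by (intro state_strictly_decreasing[OF lam k]) (auto simp: valid_slotsD)
  have "(\<Sum>i = 1..r + 1. T i) = (\<Sum>i = 1..r + 1. lam i)"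
    using state_sum[OF k order.refl, of lam T] st[of r] by (simp add: T_def)
  moreover have "lower_slack lam k m T = 0 \<longleftrightarrow> c m = 1" "upper_slack lam k m T = 0 \<longleftrightarrow> c m = 0" if "m < r" for m
    using slack[OF that] pos[OF that] by auto
  ultimately show ?thesis using that feas by blast
qed

text \<open>
  At a point \<open>lam \<circ> v\<close> with code in \<open>{k, k + 1}\<close> each step deletes an entry, so the sequence consists of the
  weights not yet used, in decreasing order.  Accordingly the index of \<open>lam (v i)\<close> is the rank
  of \<open>v i\<close> among the remaining values.
\<close>

lemma state_at_permutation:
  assumes v: "v permutes {1..r + 1}"
    and "\<And>m. m < M \<Longrightarrow> code (r + 1) v (Suc m) = k (Suc m) \<or> code (r + 1) v (Suc m) = Suc (k (Suc m))"
    and "M \<le> r" "i \<in> {Suc M..r + 1}"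
  shows "state lam k (\<lambda>i. lam (v i)) M (card {j \<in> {Suc M..r + 1}. v j < v i}) = lam (v i)"
  using assms(2-)
proof (induction M arbitrary: i)
  case 0
  have "v ` {j \<in> {1..r + 1}. v j < v i} = {x \<in> v ` {1..r + 1}. x < v i}" by auto
  also have "\<dots> = {1..<v i}"
    using permutes_image[OF v] permutes_in_image[OF v, of i] 0 by auto
  finally have "card {j \<in> {1..r + 1}. v j < v i} = v i - 1"
    using card_image[OF inj_on_subset[OF permutes_inj[OF v] subset_UNIV], of "{j \<in> {1..r + 1}. v j < v i}"] by simp
  moreover have "1 \<le> v i" using permutes_in_image[OF v, of i] 0 by auto
  ultimately show ?case by simp
next
  case (Suc M)
  let ?x = "state lam k (\<lambda>i. lam (v i)) M" and ?c = "code (r + 1) v (Suc M)"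
  define R where "R i = card {j \<in> {Suc M..r + 1}. v j < v i}" for i
  define R' where "R' i = card {j \<in> {Suc (Suc M)..r + 1}. v j < v i}" for i
  have IH: "?x (R i) = lam (v i)" if "i \<in> {Suc M..r + 1}" for i
    unfolding R_def using Suc.IH Suc.prems that by simp
  have ins: "{Suc M..r + 1} = insert (Suc M) {Suc (Suc M)..r + 1}" using Suc.prems by auto
  have RR: "R i = (if v (Suc M) < v i then Suc (R' i) else R' i)" for i
  proof -
    have "{j \<in> {Suc M..r + 1}. v j < v i} = (if v (Suc M) < v i then insert (Suc M) {j \<in> {Suc (Suc M)..r + 1}. v j < v i}
        else {j \<in> {Suc (Suc M)..r + 1}. v j < v i})" unfolding ins by auto
    then show ?thesis by (simp add: R_def R'_def)
  qed
  have cR': "?c = R' (Suc M)" unfolding code_def R'_def by (rule arg_cong[of _ _ card]) auto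
  then have cR: "?c = R (Suc M)" by (simp add: RR)
  have xc: "lam (v (Suc M)) = ?x ?c" using IH[of "Suc M"] cR Suc.prems by simp
  have mono: "R' i \<le> R' j" if "v i \<le> v j" for i j
    unfolding R'_def using that by (intro card_mono) auto
  have "state lam k (\<lambda>i. lam (v i)) (Suc M) (R' i) = (if R' i < ?c then ?x (R' i) else ?x (Suc (R' i)))"
    unfolding state.simps using Suc.prems(1)[of M] xc by (intro merge_at_end) auto
  also have "\<dots> = ?x (R i)"
  proof (cases "v (Suc M) < v i")
    case True
    then show ?thesis using RR[of i] mono[of "Suc M" i] cR' by simp
  next
    case False
    have "v i \<noteq> v (Suc M)" using permutes_inj[OF v] Suc.prems by (auto simp: inj_eq)
    then have lt: "v i < v (Suc M)" using False by simp
    have "{j \<in> {Suc (Suc M)..r + 1}. v j < v i} \<subset> {j \<in> {Suc (Suc M)..r + 1}. v j < v (Suc M)}"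
      using lt Suc.prems by auto
    then have "R' i < R' (Suc M)" unfolding R'_def by (intro psubset_card_mono) auto
    then show ?thesis using RR[of i] False cR' by simp
  qed
  also have "\<dots> = lam (v i)" using IH[of i] Suc.prems by simp
  finally show ?case by (simp add: R'_def)
qed

lemma slack_at_permutation:
  assumes lam: "\<forall>i\<in>{1..r}. lam i > lam (i + 1)" and k: "valid_slots r k" and v: "v permutes {1..r + 1}"
    and code: "\<And>m. m < r \<Longrightarrow> code (r + 1) v (Suc m) = k (Suc m) \<or> code (r + 1) v (Suc m) = Suc (k (Suc m))"
  shows "\<And>m. m < r \<Longrightarrow> lam (v (Suc m)) = state lam k (\<lambda>i. lam (v i)) m (code (r + 1) v (Suc m))"
    and "feasible lam k (\<lambda>i. lam (v i)) r"
proof -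
  show at: "lam (v (Suc m)) = state lam k (\<lambda>i. lam (v i)) m (code (r + 1) v (Suc m))" if "m < r" for m
  proof -
    have "code (r + 1) v (Suc m) = card {j \<in> {Suc m..r + 1}. v j < v (Suc m)}"
      unfolding code_def by (rule arg_cong[of _ _ card]) (auto simp: le_eq_less_or_eq)
    then show ?thesis using state_at_permutation[OF v, of m k "Suc m" lam] code that by simp
  qed
  have "feasible lam k (\<lambda>i. lam (v i)) M" if "M \<le> r" for M
    using that
  proof (induction M)
    case (Suc M)
    then have "state lam k (\<lambda>i. lam (v i)) M (Suc (k (Suc M))) < state lam k (\<lambda>i. lam (v i)) M (k (Suc M))"
      using k by (intro state_strictly_decreasing[OF lam k]) (auto simp: valid_slotsD)
    then show ?case using Suc at[of M] code[of M]
      by (auto simp: feasible_Suc lower_slack_def upper_slack_def)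
  qed (simp add: feasible_def)
  then show "feasible lam k (\<lambda>i. lam (v i)) r" by simp
qed

text \<open>
  A discrete intermediate value argument.
\<close>

lemma slot_exists:
  assumes "s \<le> x 0" "x N \<le> s" "0 < N"
  shows "\<exists>q<N. x (Suc q) \<le> s \<and> s \<le> (x q :: real)"
  using assms(2,3)
proof (induction N)
  case (Suc N)
  show ?case
  proof (cases "s \<le> x N")
    case True then show ?thesis using Suc.prems by blast
  next
    case False
    then have "0 < N" using assms(1) by (cases N) auto
    then show ?thesis using Suc.IH False by (auto simp: less_Suc_eq)
  qed
qed simp

text \<open>
  The process can be run at any point \<open>T\<close> majorised by \<open>lam\<close>, because majorisation persists.  A partial sum of the
  merged sequence that reaches beyond slot \<open>q\<close> is a partial sum of the old one, with one more term, minus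
  \<open>T (Suc M)\<close>; adding \<open>Suc M\<close> to the index set turns the required inequality into an old one.
\<close>

lemma majorised_slots:
  assumes maj: "\<And>S. S \<subseteq> {1..r + 1} \<Longrightarrow> sum T S \<le> (\<Sum>j<card S. lam (Suc j))"
    and tot: "(\<Sum>i = 1..r + 1. T i) = (\<Sum>i = 1..r + 1. lam i)"
  obtains k where "valid_slots r k" "feasible lam k T r"
proof -
  have "\<exists>k. (\<forall>m<M. k (Suc m) + m < r) \<and> feasible lam k T M \<and>
     (\<forall>S \<subseteq> {Suc M..r + 1}. sum T S \<le> (\<Sum>j<card S. state lam k T M j)) \<and>
     sum T {Suc M..r + 1} = (\<Sum>j<r + 1 - M. state lam k T M j)" if "M \<le> r" for M
    using that
  proof (induction M)
    case 0
    have "(\<Sum>j<r + 1. lam (Suc j)) = (\<Sum>i = 1..r + 1. lam i)"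
      by (rule sum.reindex_bij_witness[of _ "\<lambda>i. i - 1" Suc]) auto
    then show ?case using maj tot by (simp add: feasible_def)
  next
    case (Suc M)
    then obtain k where k: "\<forall>m<M. k (Suc m) + m < r" "feasible lam k T M"
      "\<And>S. S \<subseteq> {Suc M..r + 1} \<Longrightarrow> sum T S \<le> (\<Sum>j<card S. state lam k T M j)"
      "sum T {Suc M..r + 1} = (\<Sum>j<r + 1 - M. state lam k T M j)" by auto
    let ?x = "state lam k T M" and ?s = "T (Suc M)"
    have "?s \<le> ?x 0" using k(3)[of "{Suc M}"] Suc.prems by simp
    moreover have "?x (r - M) \<le> ?s"
    proof -
      have "sum T {Suc M..r + 1} = ?s + sum T {Suc (Suc M)..r + 1}"
        using Suc.prems by (simp add: sum.atLeast_Suc_atMost)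
      moreover have "sum T {Suc (Suc M)..r + 1} \<le> (\<Sum>j<r - M. ?x j)"
        using k(3)[of "{Suc (Suc M)..r + 1}"] by simp
      moreover have "(\<Sum>j<r + 1 - M. ?x j) = (\<Sum>j<r - M. ?x j) + ?x (r - M)"
        using Suc.prems by (simp add: Suc_diff_le)
      ultimately show ?thesis using k(4) by simp
    qed
    ultimately obtain q where q: "q < r - M" "?x (Suc q) \<le> ?s" "?s \<le> ?x q"
      using slot_exists[of ?s ?x "r - M"] Suc.prems by auto
    define k' where "k' = k(Suc M := q)"
    have st: "state lam k' T m = state lam k T m" if "m \<le> M" for m
      using that by (intro state_cong) (auto simp: k'_def)
    have sl: "lower_slack lam k' m T = lower_slack lam k m T" "upper_slack lam k' m T = upper_slack lam k m T"
      if "m < M" for m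
      using slack_cong[of m k' k T T] that by (auto simp: k'_def)
    have "\<forall>m<Suc M. k' (Suc m) + m < r" using k(1) q(1) by (auto simp: k'_def less_Suc_eq)
    moreover have "feasible lam k' T (Suc M)"
    proof -
      have "feasible lam k' T M" using k(2) sl by (simp add: feasible_def)
      moreover have "k' (Suc M) = q" by (simp add: k'_def)
      ultimately show ?thesis using q st[of M] by (simp add: feasible_Suc lower_slack_def upper_slack_def)
    qed
    moreover have st': "state lam k' T (Suc M) = merge q ?s ?x" using st[of M] by (simp add: k'_def)
    moreover have "sum T S \<le> (\<Sum>j<card S. merge q ?s ?x j)" if S: "S \<subseteq> {Suc (Suc M)..r + 1}" for S
    proof (cases "card S \<le> q")
      case True
      then show ?thesis using k(3)[of S] S by (force simp: sum_merge)
    next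
      case False
      have fin: "finite S" "Suc M \<notin> S" using S finite_subset by auto
      have "insert (Suc M) S \<subseteq> {Suc M..r + 1}" using S Suc.prems by force
      from k(3)[OF this] show ?thesis using False fin by (simp add: sum_merge)
    qed
    moreover have "sum T {Suc (Suc M)..r + 1} = (\<Sum>j<r + 1 - Suc M. merge q ?s ?x j)"
    proof -
      have "sum T {Suc M..r + 1} = ?s + sum T {Suc (Suc M)..r + 1}"
        using Suc.prems by (simp add: sum.atLeast_Suc_atMost)
      moreover have "\<not> r + 1 - Suc M \<le> q" "Suc (r + 1 - Suc M) = r + 1 - M" using q Suc.prems by auto
      ultimately show ?thesis using k(4) by (simp only: sum_merge if_False)
    qed
    ultimately show ?case by (intro exI[of _ k']) simp
  qed
  from this[of r] show ?thesis using that by (auto simp: valid_slots_def)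
qed

section \<open>The cells\<close>

text \<open>
  The sequences of the merging process are now evaluated at the coordinates of a vector.
\<close>

locale labelled_weights =
  fixes r :: nat and e :: "nat \<Rightarrow> 'n::finite" and lam :: "nat \<Rightarrow> real"
  assumes e: "bij_betw e {1..r + 1} (UNIV :: 'n set)"
    and lam: "\<forall>i\<in>{1..r}. lam i > lam (i + 1)"
begin

abbreviation coords :: "real ^ 'n \<Rightarrow> nat \<Rightarrow> real" where
  "coords t \<equiv> \<lambda>i. t $ e i"

definition hyperplane :: "(real ^ 'n) set" where
  "hyperplane = {t. (\<Sum>i = 1..r + 1. t $ e i) = (\<Sum>i = 1..r + 1. lam i)}"

definition lower :: "(nat \<Rightarrow> nat) \<Rightarrow> nat \<Rightarrow> real ^ 'n \<Rightarrow> real" where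
  "lower k m t = lower_slack lam k m (coords t)"

definition upper :: "(nat \<Rightarrow> nat) \<Rightarrow> nat \<Rightarrow> real ^ 'n \<Rightarrow> real" where
  "upper k m t = upper_slack lam k m (coords t)"

definition cell :: "(nat \<Rightarrow> nat) \<Rightarrow> (real ^ 'n) set" where
  "cell k = {t \<in> hyperplane. feasible lam k (coords t) r}"

lemma vector_with_coords:
  obtains t :: "real ^ 'n" where "\<And>i. i \<in> {1..r + 1} \<Longrightarrow> t $ e i = T i"
  using that[of "\<chi> x. T (inv_into {1..r + 1} e x)"] bij_betw_inv_into_left[OF e] by simp

lemma coords_cong:
  assumes "\<And>i. i \<in> {1..r + 1} \<Longrightarrow> s $ e i = t $ e i" shows "s = t"
  unfolding vec_eq_iff
proof
  fix x
  obtain i where "i \<in> {1..r + 1}" "x = e i" using e by (metis UNIV_I bij_betw_def imageE)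
  then show "s $ x = t $ x" using assms by simp
qed

lemma affine_form_coord: "affine_form (\<lambda>t. t $ x)"
  by (intro affine_form_linear) (simp add: linear_iff)

lemma affine_form_coord_sum: "affine_form (\<lambda>t. \<Sum>i\<in>S. coords t i)"
  by (intro affine_form_linear) (simp add: linear_iff sum.distrib sum_distrib_left)

lemma affine_form_slacks: "affine_form (lower k m)" "affine_form (upper k m)"
  unfolding lower_def[abs_def] upper_def[abs_def] lower_slack_def upper_slack_def
  by (intro affine_form_diff affine_form_state affine_form_coord)+

lemma hyperplane_affine: "affine hyperplane"
  unfolding affine_def
proof (intro ballI allI impI)
  fix x y and u v :: real assume xy: "x \<in> hyperplane" "y \<in> hyperplane" and uv: "u + v = 1"
  then have u: "u = 1 - v" by simp
  show "u *\<^sub>R x + v *\<^sub>R y \<in> hyperplane"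
    using affine_form_combination[OF affine_form_coord_sum[of "{1..r+1}"], of v x y] xy
    unfolding hyperplane_def mem_Collect_eq u by (simp add: algebra_simps del: sum.cl_ivl_Suc)
qed

lemma hyperplane_closed: "closed hyperplane"
  unfolding hyperplane_def
  by (intro closed_Collect_eq continuous_on_affine_form affine_form_coord_sum affine_form_const)

lemma cell_cube_system:
  assumes k: "valid_slots r k" shows "cube_system {..<r} hyperplane (lower k) (upper k)"
proof
  fix t i
  assume t: "\<forall>i\<in>{..<r}. 0 \<le> lower k i t \<and> 0 \<le> upper k i t" and i: "i \<in> {..<r}" and "lower k i t = 0"
  have "state lam k (coords t) i (Suc (k (Suc i))) < state lam k (coords t) i (k (Suc i))"
    using t i valid_slotsD[OF k, of i]
    by (intro state_strictly_decreasing[OF lam k]) (auto simp: feasible_def lower_def upper_def)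
  then show "upper k i t \<noteq> 0"
    using \<open>lower k i t = 0\<close> by (simp add: lower_def upper_def lower_slack_def upper_slack_def)
next
  fix X Y assume XY: "X \<subseteq> {..<r}" "Y \<subseteq> {..<r}" "X \<inter> Y = {}"
  define c where "c m = (if m \<in> X then 1 else if m \<in> Y then 0 else 1/2 :: real)" for m
  have c: "0 \<le> c m \<and> c m \<le> 1" for m by (simp add: c_def)
  have c1: "c m = 1 \<longleftrightarrow> m \<in> X" for m by (simp add: c_def)
  have c0: "c m = 0 \<longleftrightarrow> m \<in> Y" for m using XY(3) by (auto simp: c_def)
  obtain T where T: "(\<Sum>i = 1..r + 1. T i) = (\<Sum>i = 1..r + 1. lam i)" "feasible lam k T r"
    "\<And>m. m < r \<Longrightarrow> lower_slack lam k m T = 0 \<longleftrightarrow> m \<in> X"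
    "\<And>m. m < r \<Longrightarrow> upper_slack lam k m T = 0 \<longleftrightarrow> m \<in> Y"
    by (rule realise_slacks[where c = c, OF lam k c, unfolded c1 c0]) (rule that; simp)
  obtain t where t: "\<And>i. i \<in> {1..r + 1} \<Longrightarrow> t $ e i = T i" using vector_with_coords by blast
  have sl: "lower k m t = lower_slack lam k m T" "upper k m t = upper_slack lam k m T" if "m < r" for m
    using that t unfolding lower_def upper_def by (intro slack_cong; simp)+
  have "t \<in> hyperplane" using t T(1) by (simp add: hyperplane_def del: sum.cl_ivl_Suc)
  then show "\<exists>t\<in>hyperplane. \<forall>i\<in>{..<r}. 0 \<le> lower k i t \<and> 0 \<le> upper k i t \<and>
        (lower k i t = 0) = (i \<in> X) \<and> (upper k i t = 0) = (i \<in> Y)"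
    using T(2-) by (intro bexI[of _ t]) (auto simp: sl feasible_def)
qed (auto simp: hyperplane_affine affine_form_slacks)

lemma cell_eq_body:
  assumes "valid_slots r k" shows "cell k = cube_system.body {..<r} hyperplane (lower k) (upper k)"
  unfolding cube_system.body_def[OF cell_cube_system[OF assms]]
  by (auto simp: cell_def feasible_def lower_def upper_def)

lemma cell_cong:
  assumes "\<And>i. i \<in> {1..r} \<Longrightarrow> k i = k' i" shows "cell k = cell k'"
proof -
  have "lower_slack lam k m T = lower_slack lam k' m T \<and> upper_slack lam k m T = upper_slack lam k' m T"
    if "m < r" for m T
    using slack_cong[of m k k' T T lam] assms that by simp
  then show ?thesis by (auto simp: cell_def feasible_def)
qed

text \<open>
  All coordinates are bounded by the extreme weights, the last one because the coordinate sum makes it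
  equal to the final entry of the process.
\<close>

lemma cell_compact:
  assumes k: "valid_slots r k" shows "compact (cell k)"
proof -
  have "cell k \<subseteq> cbox (\<chi> x. lam (r + 1)) (\<chi> x. lam 1)"
  proof
    fix t assume t: "t \<in> cell k"
    let ?st = "state lam k (coords t)"
    have f: "feasible lam k (coords t) r" using t by (simp add: cell_def)
    have bnd: "lam (r + 1) \<le> ?st m j \<and> ?st m j \<le> lam 1" if "m \<le> r" "j + m \<le> r" for m j
      using state_bounds[OF lam k feasible_mono[OF f] _ _] that by blast
    have "lam (r + 1) \<le> t $ e i \<and> t $ e i \<le> lam 1" if i: "i \<in> {1..r + 1}" for i
    proof (cases "i = r + 1")
      case True
      have "(\<Sum>i = 1..r + 1. t $ e i) = (\<Sum>i = 1..r + 1. lam i)" using t by (simp add: cell_def hyperplane_def)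
      then have "t $ e (r + 1) = ?st r 0"
        using state_sum[OF k order.refl, of lam "coords t"] by simp
      then show ?thesis using bnd[of r 0] True by simp
    next
      case False
      then obtain m where m: "i = Suc m" "m < r" using i by (cases i) auto
      then show ?thesis using feasibleD[OF f m(2)] bnd[of m "k i"] bnd[of m "Suc (k i)"] valid_slotsD[OF k m(2)]
        by auto
    qed
    moreover have "\<exists>i\<in>{1..r + 1}. x = e i" for x using e by (metis UNIV_I bij_betw_def imageE)
    ultimately show "t \<in> cbox (\<chi> x. lam (r + 1)) (\<chi> x. lam 1)"
      unfolding mem_box_cart by (metis vec_lambda_beta)
  qed
  then have "bounded (cell k)" using bounded_cbox bounded_subset by blast
  moreover have "closed (cell k)"
    using cube_system.closed_body[OF cell_cube_system[OF k] hyperplane_closed] by (simp add: cell_eq_body[OF k])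
  ultimately show ?thesis by (simp add: compact_eq_bounded_closed)
qed

lemma perm_point_coords: "i \<in> {1..r + 1} \<Longrightarrow> perm_point e (r + 1) lam v $ e i = lam (v i)"
  using perm_point_nth[OF e] .

lemma perm_point_in_hyperplane:
  assumes "v permutes {1..r + 1}" shows "perm_point e (r + 1) lam v \<in> hyperplane"
proof -
  have "(\<Sum>i = 1..r + 1. perm_point e (r + 1) lam v $ e i) = (\<Sum>i = 1..r + 1. lam (v i))"
    using perm_point_coords by (intro sum.cong) auto
  also have "\<dots> = (\<Sum>i = 1..r + 1. lam i)" using sum.permute[OF assms, of lam] by (simp add: o_def)
  finally show ?thesis by (simp add: hyperplane_def)
qed

lemma perm_point_in_cell:
  assumes k: "valid_slots r k" and v: "v permutes {1..r + 1}"
    and code: "\<And>i. i \<in> {1..r} \<Longrightarrow> code (r + 1) v i \<in> {k i, Suc (k i)}"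
  shows "perm_point e (r + 1) lam v \<in> cell k"
proof -
  have "feasible lam k (\<lambda>i. lam (v i)) r"
    using code by (intro slack_at_permutation(2)[OF lam k v]) auto
  moreover have "lower_slack lam k m (coords (perm_point e (r + 1) lam v)) = lower_slack lam k m (\<lambda>i. lam (v i)) \<and>
      upper_slack lam k m (coords (perm_point e (r + 1) lam v)) = upper_slack lam k m (\<lambda>i. lam (v i))" if "m < r" for m
    using that perm_point_coords by (intro conjI slack_cong) auto
  ultimately show ?thesis using perm_point_in_hyperplane[OF v] by (simp add: cell_def feasible_def)
qed

text \<open>
  At an extreme point every coordinate is an end of its slot.  The chosen ends form the code of a permutation,
  and its weight vector runs through the same sequences.
\<close>

lemma extreme_point_of_cell:
  assumes k: "valid_slots r k" and z: "z extreme_point_of cell k"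
  obtains v where "v permutes {1..r + 1}" "\<And>i. i \<in> {1..r} \<Longrightarrow> code (r + 1) v i \<in> {k i, Suc (k i)}"
    "z = perm_point e (r + 1) lam v"
proof -
  have tight: "lower k m z = 0 \<or> upper k m z = 0" if "m < r" for m
    using cube_system.extreme_point_tight[OF cell_cube_system[OF k], of z m] z that by (auto simp: cell_eq_body[OF k])
  define c where "c i = (if i = r + 1 then 0 else if lower k (i - 1) z = 0 then Suc (k i) else k i)" for i
  have "c i + i \<le> r + 1" if "i \<in> {1..r + 1}" for i
    using that valid_slots_le[OF k, of i] by (auto simp: c_def)
  then obtain v where v: "v permutes {1..r + 1}" "\<And>i. i \<in> {1..r + 1} \<Longrightarrow> code (r + 1) v i = c i"
    using code_surj[of "r + 1" c] by blast
  have code: "code (r + 1) v i \<in> {k i, Suc (k i)}" if "i \<in> {1..r}" for i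
    using that v(2)[of i] by (auto simp: c_def)
  have at: "lam (v (Suc m)) = state lam k (\<lambda>i. lam (v i)) m (code (r + 1) v (Suc m))" if "m < r" for m
    using slack_at_permutation(1)[OF lam k v(1) _ that] code by auto
  have eq: "\<forall>i\<in>{1..m}. z $ e i = lam (v i)" if "m \<le> r" for m
    using that
  proof (induction m)
    case (Suc m)
    have "state lam k (coords z) m = state lam k (\<lambda>i. lam (v i)) m" using Suc by (intro state_cong) auto
    then have "z $ e (Suc m) = lam (v (Suc m))"
      using at[of m] tight[of m] v(2)[of "Suc m"] Suc.prems
      by (auto simp: c_def lower_def upper_def lower_slack_def upper_slack_def)
    then show ?case using Suc by (auto simp: le_Suc_eq)
  qed simp
  have "z $ e i = lam (v i)" if "i \<in> {1..r + 1}" for i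
  proof (cases "i = r + 1")
    case True
    have "(\<Sum>i = 1..r + 1. z $ e i) = (\<Sum>i = 1..r + 1. lam i)"
      using z by (auto simp: extreme_point_of_def cell_def hyperplane_def)
    also have "\<dots> = (\<Sum>i = 1..r + 1. lam (v i))" using sum.permute[OF v(1), of lam] by (simp add: o_def)
    finally have "(\<Sum>i = 1..r. z $ e i) + z $ e (r + 1) = (\<Sum>i = 1..r. lam (v i)) + lam (v (r + 1))" by simp
    moreover have "(\<Sum>i = 1..r. z $ e i) = (\<Sum>i = 1..r. lam (v i))" using eq[of r] by (intro sum.cong) auto
    ultimately show ?thesis using True by simp
  next
    case False
    then show ?thesis using eq[of r] that by auto
  qed
  then have "z = perm_point e (r + 1) lam v" using perm_point_coords by (intro coords_cong) simp
  then show ?thesis using that v(1) code by blast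
qed

lemma valid_slots_code: "valid_slots r (code r u)"
proof -
  have "code r u (Suc m) + m < r" if "m < r" for m using code_le[of r u "Suc m"] that by linarith
  then show ?thesis by (simp add: valid_slots_def)
qed

text \<open>
  The vertices of the cell are the points of the interval, because both are described by the code.
\<close>

lemma bruhat_cube_eq_cell:
  assumes u: "u permutes {1..r}"
  shows "bruhat_cube e r lam u = cell (code r u)"
proof
  note k = valid_slots_code[of u]
  have convex: "convex (cell (code r u))"
    using cube_system.convex_body[OF cell_cube_system[OF k]] by (simp add: cell_eq_body[OF k])
  have vert: "v \<in> cube_interval r u \<longleftrightarrow> v permutes {1..r + 1} \<and>
      (\<forall>i\<in>{1..r}. code (r + 1) v i \<in> {code r u i, Suc (code r u i)})" for v
    using cube_interval_iff_code[OF u, of v] by simp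
  show "bruhat_cube e r lam u \<subseteq> cell (code r u)"
    unfolding bruhat_cube_def
  proof (rule hull_minimal)
    show "perm_point e (r + 1) lam ` cube_interval r u \<subseteq> cell (code r u)"
      using vert perm_point_in_cell[OF k] by blast
  qed (rule convex)
  have "{z. z extreme_point_of cell (code r u)} \<subseteq> perm_point e (r + 1) lam ` cube_interval r u"
  proof
    fix z assume "z \<in> {z. z extreme_point_of cell (code r u)}"
    then obtain v where "v permutes {1..r + 1}" "\<And>i. i \<in> {1..r} \<Longrightarrow> code (r + 1) v i \<in> {code r u i, Suc (code r u i)}"
      "z = perm_point e (r + 1) lam v" using extreme_point_of_cell[OF k] by blast
    then show "z \<in> perm_point e (r + 1) lam ` cube_interval r u" using vert by blast
  qed
  then show "cell (code r u) \<subseteq> bruhat_cube e r lam u"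
    unfolding bruhat_cube_def by (subst Krein_Milman_Minkowski[OF cell_compact[OF k] convex]) (rule hull_mono)
qed

lemma finite_cube_interval: "finite (cube_interval r u)"
proof -
  have "cube_interval r u \<subseteq> {v. v permutes {1..r + 1}}" by (auto simp: cube_interval_def bruhat_le_def)
  then show ?thesis using finite_permutations finite_subset by blast
qed

lemma polytope_bruhat_cube: "polytope (bruhat_cube e r lam u)"
  unfolding bruhat_cube_def polytope_def using finite_cube_interval by blast

text \<open>
  The cell and the standard cube are systems over the same index set \<open>{..<r}\<close>.
\<close>

lemma combinatorial_cube_bruhat_cube:
  assumes u: "u permutes {1..r}" shows "combinatorial_cube r (bruhat_cube e r lam u)"
proof -
  note k = valid_slots_code[of u]
  have "r \<le> card (Basis :: (real ^ 'n) set)"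
    using bij_betw_same_card[OF e] by simp
  then obtain B :: "(real ^ 'n) set" where B: "B \<subseteq> Basis" "card B = r"
    by (metis obtain_subset_with_card_n)
  then have "finite B" using finite_subset finite_Basis by blast
  then obtain \<beta> where \<beta>: "bij_betw \<beta> {..<r} B"
    using ex_bij_betw_nat_finite[of B] B(2) by (auto simp: atLeast0LessThan)
  then have \<beta>': "inj_on \<beta> {..<r}" "\<beta> ` {..<r} = B" by (auto simp: bij_betw_def)
  have "face_lattice_iso (cell (code r u)) (cbox 0 (\<Sum>(\<beta> ` {..<r})))"
    using cube_systems_face_lattice_iso[OF cell_cube_system[OF k]
        cube_system_standard_cube(1)[of "{..<r}" \<beta>]] \<beta>' B(1)
      cube_system_standard_cube(2)[of "{..<r}" \<beta>]
    by (simp add: cell_eq_body[OF k])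
  then show ?thesis
    unfolding combinatorial_cube_def \<beta>'(2) bruhat_cube_eq_cell[OF u, symmetric]
    using polytope_bruhat_cube B by blast
qed

section \<open>The subdivision\<close>

text \<open>
  Two cells meet exactly where all slots in which they differ are tied, and ties are tight constraints of the
  first cell.  If some slots are further apart than one step, the cells are disjoint.
\<close>

lemma cells_Int_face_of:
  assumes k: "valid_slots r k" "valid_slots r k'"
  shows "cell k \<inter> cell k' face_of cell k"
proof (cases "\<forall>m<r. k' (Suc m) = k (Suc m) \<or> k' (Suc m) = Suc (k (Suc m)) \<or> k (Suc m) = Suc (k' (Suc m))")
  case True
  let ?X = "{m. m < r \<and> k' (Suc m) = Suc (k (Suc m))}" and ?Y = "{m. m < r \<and> k (Suc m) = Suc (k' (Suc m))}"
  interpret cube_system "{..<r}" hyperplane "lower k" "upper k" by (rule cell_cube_system[OF k(1)])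
  have "cell k \<inter> cell k' = face ?X ?Y"
  proof (intro equalityI subsetI)
    fix t assume t: "t \<in> cell k \<inter> cell k'"
    then have f: "feasible lam k (coords t) r" "feasible lam k' (coords t) r" by (auto simp: cell_def)
    show "t \<in> face ?X ?Y"
      using t states_meet[OF lam k f]
      by (fastforce simp: face_def cell_eq_body[OF k(1), symmetric] lower_def upper_def)
  next
    fix t assume t: "t \<in> face ?X ?Y"
    then have tk: "t \<in> cell k" and z: "\<And>m. m \<in> ?X \<Longrightarrow> lower k m t = 0" "\<And>m. m \<in> ?Y \<Longrightarrow> upper k m t = 0"
      by (auto simp: face_def cell_eq_body[OF k(1), symmetric])
    have "feasible lam k' (coords t) r"
      using tk True z
      by (intro feasible_transfer[OF lam k]) (auto simp: cell_def lower_def upper_def)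
    then show "t \<in> cell k \<inter> cell k'" using tk by (simp add: cell_def)
  qed
  moreover have "face ?X ?Y face_of body" by (rule face_face_of) auto
  ultimately show ?thesis by (simp add: cell_eq_body[OF k(1)])
next
  case False
  have "cell k \<inter> cell k' = {}"
    using False states_meet[OF lam k] by (fastforce simp: cell_def)
  then show ?thesis by simp
qed

text \<open>
  A point of the first cell without tight constraints lies in no other cell.
\<close>

lemma cell_subset_imp_eq:
  assumes k: "valid_slots r k" "valid_slots r k'" and sub: "cell k \<subseteq> cell k'" and i: "i \<in> {1..r}"
  shows "k i = k' i"
proof -
  interpret cube_system "{..<r}" hyperplane "lower k" "upper k" by (rule cell_cube_system[OF k(1)])
  obtain t where t: "t \<in> face {} {}" "\<And>i. i \<in> {..<r} \<Longrightarrow> lower k i t = 0 \<longleftrightarrow> i \<in> {}"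
    "\<And>i. i \<in> {..<r} \<Longrightarrow> upper k i t = 0 \<longleftrightarrow> i \<in> {}" using realised_face[of "{}" "{}"] by auto
  have "t \<in> cell k" using t(1) by (simp add: face_def cell_eq_body[OF k(1)])
  then have "feasible lam k (coords t) r" "feasible lam k' (coords t) r" using sub by (auto simp: cell_def)
  from states_meet[OF lam k this, of "i - 1"] show ?thesis
    using t(2,3)[of "i - 1"] i by (auto simp: lower_def upper_def)
qed

lemma bruhat_cube_subset_imp_eq:
  assumes "u permutes {1..r}" "w permutes {1..r}" "bruhat_cube e r lam u \<subseteq> bruhat_cube e r lam w"
  shows "u = w"
proof (rule code_inj[OF assms(1,2)])
  have "cell (code r u) \<subseteq> cell (code r w)"
    using assms(3) unfolding bruhat_cube_eq_cell[OF assms(1)] bruhat_cube_eq_cell[OF assms(2)] .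
  then show "code r u i = code r w i" if "i \<in> {1..r}" for i
    using that by (rule cell_subset_imp_eq[OF valid_slots_code valid_slots_code])
qed

lemma card_bruhat_cubes: "card (bruhat_cube e r lam ` {u. u permutes {1..r}}) = fact r"
proof -
  have "inj_on (bruhat_cube e r lam) {u. u permutes {1..r}}"
    using bruhat_cube_subset_imp_eq by (auto intro!: inj_onI)
  then show ?thesis using card_permutations[of "{1..r}" r] by (simp add: card_image)
qed

lemma sum_le_initial:
  assumes "S \<subseteq> {1..n}" "n \<le> r + 1"
  shows "sum lam S \<le> (\<Sum>j<card S. lam (Suc j))"
  using assms
proof (induction n arbitrary: S)
  case (Suc n)
  have antimono: "lam (Suc j) \<le> lam (Suc i)" if "i \<le> j" "j \<le> r" for i j
    using that
  proof (induction j)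
    case (Suc j)
    then show ?case using bspec[OF lam, of "Suc j"] by (cases "i = Suc j") auto
  qed simp
  show ?case
  proof (cases "Suc n \<in> S")
    case True
    let ?S = "S - {Suc n}"
    have sub: "?S \<subseteq> {1..n}" using Suc.prems by (auto simp: le_Suc_eq)
    have fin: "finite S" using Suc.prems finite_subset by auto
    have "card ?S \<le> n" using card_mono[OF _ sub] by simp
    then have "lam (Suc n) \<le> lam (Suc (card ?S))" using antimono Suc.prems by simp
    moreover have "sum lam S = sum lam ?S + lam (Suc n)" using True fin by (simp add: sum.remove)
    moreover have "card S = Suc (card ?S)" using card.remove[OF fin True] .
    ultimately show ?thesis using Suc.IH[OF sub] Suc.prems by simp
  next
    case False
    then have "S \<subseteq> {1..n}" using Suc.prems by (auto simp: le_Suc_eq subset_iff)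
    then show ?thesis using Suc by simp
  qed
qed simp

text \<open>
  The easy half of Rado's theorem: these inequalities are linear and hold at the vertices.
\<close>

lemma permutahedron_majorised:
  assumes t: "t \<in> permutahedron e (r + 1) lam"
  shows "t \<in> hyperplane" "S \<subseteq> {1..r + 1} \<Longrightarrow> (\<Sum>i\<in>S. t $ e i) \<le> (\<Sum>j<card S. lam (Suc j))"
proof -
  let ?V = "perm_point e (r + 1) lam ` {w. w permutes {1..r + 1}}"
  have "convex hull ?V \<subseteq> hyperplane"
    using perm_point_in_hyperplane by (intro hull_minimal affine_imp_convex hyperplane_affine) auto
  then show "t \<in> hyperplane" using t by (auto simp: permutahedron_def)
  assume S: "S \<subseteq> {1..r + 1}"
  let ?H = "{t. (\<Sum>i\<in>S. t $ e i) \<le> (\<Sum>j<card S. lam (Suc j))}"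
  have "convex ?H"
    unfolding convex_alt
  proof (intro ballI allI impI)
    fix x y and c :: real assume xy: "x \<in> ?H" "y \<in> ?H" and c: "0 \<le> c \<and> c \<le> 1"
    show "(1 - c) *\<^sub>R x + c *\<^sub>R y \<in> ?H"
      using affine_form_combination[OF affine_form_coord_sum[of S], of c x y] xy c
        convex_bound_le[of "\<Sum>i\<in>S. x $ e i" _ "\<Sum>i\<in>S. y $ e i" "1 - c" c] by simp
  qed
  moreover have "?V \<subseteq> ?H"
  proof clarify
    fix w assume w: "w permutes {1..r + 1}"
    have inj: "inj_on w S" using permutes_inj[OF w] inj_on_subset by blast
    have "(\<Sum>i\<in>S. perm_point e (r + 1) lam w $ e i) = (\<Sum>i\<in>S. lam (w i))"
      using S perm_point_coords by (intro sum.cong) auto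
    also have "\<dots> = sum lam (w ` S)" using inj by (simp add: sum.reindex)
    also have "\<dots> \<le> (\<Sum>j<card (w ` S). lam (Suc j))"
      using S permutes_image[OF w] by (intro sum_le_initial[of _ "r + 1"]) auto
    finally show "(\<Sum>i\<in>S. perm_point e (r + 1) lam w $ e i) \<le> (\<Sum>j<card S. lam (Suc j))"
      using inj by (simp add: card_image)
  qed
  ultimately have "convex hull ?V \<subseteq> ?H" by (intro hull_minimal) auto
  then show "(\<Sum>i\<in>S. t $ e i) \<le> (\<Sum>j<card S. lam (Suc j))" using t by (auto simp: permutahedron_def)
qed

lemma Union_bruhat_cubes: "(\<Union>u\<in>{u. u permutes {1..r}}. bruhat_cube e r lam u) = permutahedron e (r + 1) lam"
proof (intro equalityI subsetI)
  fix t assume "t \<in> (\<Union>u\<in>{u. u permutes {1..r}}. bruhat_cube e r lam u)"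
  then obtain u where "t \<in> bruhat_cube e r lam u" by blast
  moreover have "bruhat_cube e r lam u \<subseteq> permutahedron e (r + 1) lam"
    unfolding bruhat_cube_def permutahedron_def
    by (intro hull_mono) (auto simp: cube_interval_def bruhat_le_def)
  ultimately show "t \<in> permutahedron e (r + 1) lam" by blast
next
  fix t assume t: "t \<in> permutahedron e (r + 1) lam"
  have hyp: "t \<in> hyperplane" by (rule permutahedron_majorised(1)[OF t])
  obtain k where k: "valid_slots r k" "feasible lam k (coords t) r"
    using majorised_slots[of r "coords t" lam] permutahedron_majorised(2)[OF t] hyp
    unfolding hyperplane_def by blast
  have "k i + i \<le> r" if "i \<in> {1..r}" for i using valid_slots_le[OF k(1) that] .
  then obtain u where u: "u permutes {1..r}" "\<And>i. i \<in> {1..r} \<Longrightarrow> code r u i = k i"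
    using code_surj by metis
  have "t \<in> cell k" using k hyp by (simp add: cell_def)
  then have "t \<in> bruhat_cube e r lam u" using cell_cong[of "code r u" k] u bruhat_cube_eq_cell by simp
  then show "t \<in> (\<Union>u\<in>{u. u permutes {1..r}}. bruhat_cube e r lam u)" using u by blast
qed

text \<open>
  The complex consists of all faces of all cubes; intersections of faces are faces because this holds for the
  cubes themselves.
\<close>

lemma bruhat_cubes_subdivision:
  "\<exists>K. polyhedral_subdivision K (permutahedron e (r + 1) lam) \<and>
    maximal_faces K = bruhat_cube e r lam ` {u. u permutes {1..r}}"
proof -
  let ?C = "bruhat_cube e r lam" and ?U = "{u. u permutes {1..r}}"
  define K where "K = (\<Union>u\<in>?U. {F. F face_of ?C u})"
  have meet: "?C u \<inter> ?C w face_of ?C u" "?C u \<inter> ?C w face_of ?C w" if "u \<in> ?U" "w \<in> ?U" for u w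
    using that cells_Int_face_of[OF valid_slots_code valid_slots_code, of u w]
      cells_Int_face_of[OF valid_slots_code valid_slots_code, of w u]
    by (simp_all add: bruhat_cube_eq_cell Int_commute)
  have self: "?C u \<in> K" if "u \<in> ?U" for u
    using that polytope_imp_convex[OF polytope_bruhat_cube] by (auto simp: K_def face_of_refl)
  have KE: "\<exists>u\<in>?U. F face_of ?C u" if "F \<in> K" for F using that by (auto simp: K_def)
  have "polyhedral_subdivision K (permutahedron e (r + 1) lam)"
    unfolding polyhedral_subdivision_def
  proof (intro conjI ballI allI impI)
    show "finite K" unfolding K_def
      by (intro finite_UN_I finite_polytope_faces polytope_bruhat_cube finite_permutations) auto
    show "polytope S" if "S \<in> K" for S
      using KE[OF that] polytope_bruhat_cube face_of_polytope_polytope by blast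
    show "F \<in> K" if "S \<in> K \<and> F face_of S" for S F
      using that face_of_trans by (auto simp: K_def)
    show "S \<inter> T face_of S" "S \<inter> T face_of T" if "S \<in> K" "T \<in> K" for S T
      using KE[OF that(1)] KE[OF that(2)] face_of_Int_subface meet by blast+
    show "\<Union> K = permutahedron e (r + 1) lam"
    proof
      show "\<Union> K \<subseteq> permutahedron e (r + 1) lam"
        unfolding Union_bruhat_cubes[symmetric] using KE face_of_imp_subset by blast
      show "permutahedron e (r + 1) lam \<subseteq> \<Union> K"
        unfolding Union_bruhat_cubes[symmetric] using self by blast
    qed
  qed
  moreover have "maximal_faces K = ?C ` ?U"
  proof (intro equalityI subsetI)
    fix S assume S: "S \<in> maximal_faces K"
    then obtain u where u: "u \<in> ?U" "S face_of ?C u" using KE by (auto simp: maximal_faces_def)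
    then have "?C u = S" using S self[OF u(1)] face_of_imp_subset[OF u(2)] by (auto simp: maximal_faces_def)
    then show "S \<in> ?C ` ?U" using u by blast
  next
    fix S assume "S \<in> ?C ` ?U"
    then obtain u where u: "u \<in> ?U" "S = ?C u" by blast
    have "T = S" if T: "T \<in> K" "S \<subseteq> T" for T
    proof -
      obtain w where w: "w \<in> ?U" "T face_of ?C w" using KE[OF T(1)] by blast
      have Tw: "T \<subseteq> ?C w" by (rule face_of_imp_subset[OF w(2)])
      then have "u = w" using u w T(2) bruhat_cube_subset_imp_eq by auto
      then show ?thesis using T(2) Tw u(2) by blast
    qed
    then show "S \<in> maximal_faces K" using self u by (auto simp: maximal_faces_def)
  qed
  ultimately show ?thesis by blast
qed

section \<open>The facet inequalities\<close>

lemma left_len_props: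
  assumes u: "u permutes {1..r}" and i: "i \<in> {1..r}"
  shows "left_len u i < i" "\<And>j. j \<in> {i - left_len u i..<i} \<Longrightarrow> u j < u i"
    "i - left_len u i = 1 \<or> u i < u (i - left_len u i - 1)"
proof -
  let ?P = "\<lambda>f. f < i \<and> (\<forall>j\<in>{i - f..<i}. u j < u i)"
  have P0: "?P 0" using i by auto
  have P: "?P (left_len u i)" unfolding left_len_def by (rule GreatestI_nat[of ?P 0 i]) (use P0 in auto)
  then show f: "left_len u i < i" "\<And>j. j \<in> {i - left_len u i..<i} \<Longrightarrow> u j < u i" by auto
  have le: "f \<le> left_len u i" if "?P f" for f
    unfolding left_len_def using that by (rule Greatest_le_nat[where b = i]) auto
  show "i - left_len u i = 1 \<or> u i < u (i - left_len u i - 1)"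
  proof (rule ccontr)
    let ?f = "left_len u i"
    assume neg: "\<not> (i - ?f = 1 \<or> u i < u (i - ?f - 1))"
    have "u (i - ?f - 1) \<noteq> u i" using permutes_inj[OF u] i by (auto simp: inj_eq)
    then have lt: "u (i - ?f - 1) < u i" using neg by simp
    have "u j < u i" if "j \<in> {i - Suc ?f..<i}" for j
      using that lt f(2)[of j] by (cases "j = i - ?f - 1") auto
    then have "?P (Suc ?f)" using neg f(1) by auto
    then show False using le[of "Suc ?f"] by simp
  qed
qed

lemma right_len_props:
  assumes u: "u permutes {1..r}" and i: "i \<in> {1..r}"
  shows "i + right_len r u i \<le> r" "\<And>j. j \<in> {i<..i + right_len r u i} \<Longrightarrow> u j < u i"
    "u i < u (i + right_len r u i + 1)"
proof -
  let ?P = "\<lambda>g. i + g \<le> r \<and> (\<forall>j\<in>{i<..i + g}. u j < u i)"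
  have P0: "?P 0" using i by auto
  have P: "?P (right_len r u i)" unfolding right_len_def by (rule GreatestI_nat[of ?P 0 r]) (use P0 in auto)
  then show g: "i + right_len r u i \<le> r" "\<And>j. j \<in> {i<..i + right_len r u i} \<Longrightarrow> u j < u i" by auto
  have le: "g \<le> right_len r u i" if "?P g" for g
    unfolding right_len_def using that by (rule Greatest_le_nat[where b = r]) auto
  let ?g = "right_len r u i"
  show "u i < u (i + ?g + 1)"
  proof (cases "i + ?g = r")
    case True
    then have "u (i + ?g + 1) = r + 1" using u by (simp add: permutes_not_in)
    moreover have "u i \<in> {1..r}" using permutes_in_image[OF u] i by blast
    ultimately show ?thesis by simp
  next
    case False
    show ?thesis
    proof (rule ccontr)
      assume "\<not> u i < u (i + ?g + 1)"
      moreover have "u (i + ?g + 1) \<noteq> u i" using permutes_inj[OF u] by (auto simp: inj_eq)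
      ultimately have lt: "u (i + ?g + 1) < u i" by simp
      have "u j < u i" if "j \<in> {i<..i + Suc ?g}" for j
        using that lt g(2)[of j] by (cases "j = i + ?g + 1") auto
      then have "?P (Suc ?g)" using False g(1) by auto
      then show False using le[of "Suc ?g"] by simp
    qed
  qed
qed

text \<open>
  For a position \<open>i\<close> whose label \<open>u i\<close> is still unprocessed after \<open>m\<close> steps, this is the index of the entry of the
  sequence that ends at position \<open>i\<close>.
\<close>

definition larger_before :: "(nat \<Rightarrow> nat) \<Rightarrow> nat \<Rightarrow> nat \<Rightarrow> nat" where
  "larger_before u m i = card {j \<in> {1..<i}. m < u j}"

lemma code_inv_eq_larger_before:
  assumes u: "u permutes {1..r}" and i: "i \<in> {1..r}"
  shows "code r (inv u) (u i) = larger_before u (u i) i"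
proof -
  have "{j \<in> {u i<..r}. inv u j < inv u (u i)} = u ` {j \<in> {1..<i}. u i < u j}"
  proof (intro equalityI subsetI)
    fix x assume x: "x \<in> {j \<in> {u i<..r}. inv u j < inv u (u i)}"
    have "inv u x \<in> {1..r}" using x permutes_in_image[OF permutes_inv[OF u], of x] by auto
    moreover have "x = u (inv u x)" using permutes_inverses[OF u] by simp
    ultimately show "x \<in> u ` {j \<in> {1..<i}. u i < u j}"
      using x permutes_inverses[OF u] by (intro image_eqI[of _ _ "inv u x"]) auto
  next
    fix x assume "x \<in> u ` {j \<in> {1..<i}. u i < u j}"
    then obtain j where j: "j \<in> {1..<i}" "u i < u j" "x = u j" by blast
    have "u j \<in> {1..r}" using permutes_in_image[OF u, of j] i j by auto
    then show "x \<in> {j \<in> {u i<..r}. inv u j < inv u (u i)}" using j permutes_inverses[OF u] by auto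
  qed
  then show ?thesis
    by (simp add: code_def larger_before_def card_image inj_on_subset[OF permutes_inj[OF u]])
qed

text \<open>
  Partial sums of the sequence have a closed form that does not depend on how the entries were merged:
  up to a position whose label is still unprocessed, the total weight is conserved except for the coordinates
  already removed.
\<close>

lemma state_prefix_sum:
  assumes u: "u permutes {1..r}" and "m \<le> r" "i \<in> {1..r + 1}" "m < u i"
  shows "(\<Sum>j<Suc (larger_before u m i). state lam (code r (inv u)) T m j) =
    (\<Sum>j = 1..i. lam j) - (\<Sum>j\<in>{j \<in> {1..<i}. u j \<le> m}. T (u j))"
  using assms(2-)
proof (induction m arbitrary: i)
  case 0
  have pos: "0 < u j" if "j \<in> {1..<i}" for j using that permutes_in_image[OF u, of j] 0 by auto
  then have "{j \<in> {1..<i}. 0 < u j} = {1..<i}" "{j \<in> {1..<i}. u j \<le> 0} = {}" by fastforce+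
  moreover have "(\<Sum>j<i. lam (Suc j)) = (\<Sum>j = 1..i. lam j)"
    by (rule sum.reindex_bij_witness[of _ "\<lambda>i. i - 1" Suc]) auto
  ultimately show ?case using 0 by (simp add: larger_before_def del: sum.cl_ivl_Suc sum.lessThan_Suc)
next
  case (Suc m)
  define p where "p = inv u (Suc m)"
  have up: "u p = Suc m" using permutes_inverses[OF u] by (simp add: p_def)
  have p: "p \<in> {1..r}" using permutes_in_image[OF permutes_inv[OF u], of "Suc m"] Suc.prems by (simp add: p_def)
  have uq: "u j = Suc m \<longleftrightarrow> j = p" for j using up permutes_inj[OF u] by (metis injD)
  have big: "Suc m < u j \<longleftrightarrow> m < u j \<and> j \<noteq> p" for j using uq[of j] by auto
  have small: "u j \<le> Suc m \<longleftrightarrow> u j \<le> m \<or> j = p" for j using uq[of j] by auto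
  let ?k = "code r (inv u)" and ?x = "state lam (code r (inv u)) T m"
  have k: "?k (Suc m) = larger_before u m p"
  proof -
    have "{j \<in> {1..<p}. Suc m < u j} = {j \<in> {1..<p}. m < u j}" by (auto simp: big)
    then show ?thesis using code_inv_eq_larger_before[OF u p] up by (simp add: larger_before_def)
  qed
  have IH: "sum ?x {..<Suc (larger_before u m i)} = (\<Sum>j = 1..i. lam j) - (\<Sum>j\<in>{j \<in> {1..<i}. u j \<le> m}. T (u j))"
    using Suc by simp
  have st: "sum (state lam ?k T (Suc m)) {..<L} = (if L \<le> larger_before u m p then sum ?x {..<L} else sum ?x {..<Suc L} - T (Suc m))" for L
    unfolding state.simps k[symmetric] by (rule sum_merge)
  have "i \<noteq> p" using Suc.prems up by auto
  then consider "i < p" | "p < i" by linarith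
  then show ?case
  proof cases
    case 1
    then have "{j \<in> {1..<i}. Suc m < u j} = {j \<in> {1..<i}. m < u j}"
      "{j \<in> {1..<i}. u j \<le> Suc m} = {j \<in> {1..<i}. u j \<le> m}"
      by (auto simp: big small)
    then have eq: "larger_before u (Suc m) i = larger_before u m i"
      "(\<Sum>j\<in>{j \<in> {1..<i}. u j \<le> Suc m}. T (u j)) = (\<Sum>j\<in>{j \<in> {1..<i}. u j \<le> m}. T (u j))"
      by (simp_all add: larger_before_def)
    have "i \<in> {j \<in> {1..<p}. m < u j}" "i \<notin> {j \<in> {1..<i}. m < u j}" using 1 Suc.prems by auto
    moreover have "{j \<in> {1..<i}. m < u j} \<subseteq> {j \<in> {1..<p}. m < u j}" using 1 by auto
    ultimately have "{j \<in> {1..<i}. m < u j} \<subset> {j \<in> {1..<p}. m < u j}" by blast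
    then have "larger_before u m i < larger_before u m p"
      unfolding larger_before_def by (intro psubset_card_mono) auto
    then show ?thesis using st[of "Suc (larger_before u m i)"] eq IH by simp
  next
    case 2
    have "{j \<in> {1..<i}. m < u j} = insert p {j \<in> {1..<i}. Suc m < u j}"
      using 2 p up by (auto simp: big)
    then have lb: "larger_before u m i = Suc (larger_before u (Suc m) i)" by (simp add: larger_before_def up)
    have "{j \<in> {1..<i}. u j \<le> Suc m} = insert p {j \<in> {1..<i}. u j \<le> m}"
      using 2 p by (auto simp: small)
    then have sm: "(\<Sum>j\<in>{j \<in> {1..<i}. u j \<le> Suc m}. T (u j)) = T (Suc m) + (\<Sum>j\<in>{j \<in> {1..<i}. u j \<le> m}. T (u j))"
      by (simp add: up)
    have "{j \<in> {1..<p}. m < u j} \<subseteq> {j \<in> {1..<i}. Suc m < u j}"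
      using 2 by (auto simp: big)
    then have "larger_before u m p \<le> larger_before u (Suc m) i"
      unfolding larger_before_def by (intro card_mono) auto
    then have "\<not> Suc (larger_before u (Suc m) i) \<le> larger_before u m p" by simp
    then have "sum (state lam ?k T (Suc m)) {..<Suc (larger_before u (Suc m) i)} =
        sum ?x {..<Suc (larger_before u m i)} - T (Suc m)"
      unfolding st lb by (simp only: if_False)
    then show ?thesis using IH sm by simp
  qed
qed

text \<open>
  When \<open>t\<^bsub>u i\<^esub>\<close> is removed, the unprocessed labels are those at least \<open>u i\<close>.  The nearest ones before and
  after position \<open>i\<close> bound the runs of smaller labels, so each end of the slot is a difference of two consecutive
  partial sums from \<open>state_prefix_sum\<close>, taken over exactly one run.
\<close>

lemma slacks_eq_facet_inequalities:
  assumes u: "u permutes {1..r}" and i: "i \<in> {1..r}"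
  shows "upper (code r (inv u)) (u i - 1) t = left_rhs lam u i - left_lhs e u i t"
    and "lower (code r (inv u)) (u i - 1) t = right_lhs e r u i t - right_rhs r lam u i"
proof -
  let ?k = "code r (inv u)"
  define m where "m = u i - 1"
  have ui: "u i \<in> {1..r}" using permutes_in_image[OF u] i by blast
  then have m: "u i = Suc m" "m \<le> r" by (auto simp: m_def)
  let ?x = "state lam ?k (coords t) m"
  define X where "X L = sum ?x {..<L}" for L
  define W where "W i = (\<Sum>j = 1..i. lam j) - (\<Sum>j\<in>{j \<in> {1..<i}. u j \<le> m}. t $ e (u j))" for i
  have pre: "X (Suc (larger_before u m p)) = W p" if "p \<in> {1..r + 1}" "m < u p" for p
    unfolding X_def W_def by (rule state_prefix_sum[OF u m(2) that])
  have ne: "u j \<noteq> Suc m" if "j \<noteq> i" for j using that m(1) permutes_inj[OF u] by (metis injD)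
  have k: "?k (Suc m) = larger_before u m i"
  proof -
    have "m < u j \<longleftrightarrow> Suc m < u j" if "j < i" for j using ne[of j] that by auto
    then show ?thesis using code_inv_eq_larger_before[OF u i] m(1)
      unfolding larger_before_def by (auto intro!: arg_cong[of _ _ card])
  qed
  have Xi: "X (Suc (?k (Suc m))) = W i" using pre[of i] i m k by simp
  show "upper ?k (u i - 1) t = left_rhs lam u i - left_lhs e u i t"
  proof -
    \<comment> \<open>The left run occupies the positions \<open>a, ..., i - 1\<close>.\<close>
    define a where "a = i - left_len u i"
    note L = left_len_props[OF u i]
    have a: "1 \<le> a" "a \<le> i" using L(1) i by (auto simp: a_def)
    have run: "u j \<le> m" if "a \<le> j" "j < i" for j using L(2)[of j] that m by (auto simp: a_def)
    have "X (?k (Suc m)) = (\<Sum>j = 1..<a. lam j) - (\<Sum>j\<in>{j \<in> {1..<a}. u j \<le> m}. t $ e (u j))"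
    proof (cases "a = 1")
      case True
      then have "{j \<in> {1..<i}. m < u j} = {}" using run by force
      then have "larger_before u m i = 0" by (simp only: larger_before_def card.empty)
      then show ?thesis using True k by (simp add: X_def)
    next
      case False
      then have a1: "m < u (a - 1)" "1 \<le> a - 1" using L(3) a m by (auto simp: a_def)
      have "{j \<in> {1..<i}. m < u j} = insert (a - 1) {j \<in> {1..<a - 1}. m < u j}"
      proof (intro equalityI subsetI)
        fix j assume "j \<in> {j \<in> {1..<i}. m < u j}"
        moreover from this have "\<not> a \<le> j" using run[of j] by auto
        ultimately show "j \<in> insert (a - 1) {j \<in> {1..<a - 1}. m < u j}" by auto
      qed (use a a1 in auto)
      then have "larger_before u m i = Suc (larger_before u m (a - 1))" by (simp add: larger_before_def)
      then have "X (?k (Suc m)) = W (a - 1)" using pre[of "a - 1"] a1 a i k by simp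
      moreover have "{j \<in> {1..<a}. u j \<le> m} = {j \<in> {1..<a - 1}. u j \<le> m}"
      proof (intro equalityI subsetI)
        fix j assume "j \<in> {j \<in> {1..<a}. u j \<le> m}"
        moreover from this have "j \<noteq> a - 1" using a1 by auto
        ultimately show "j \<in> {j \<in> {1..<a - 1}. u j \<le> m}" by auto
      qed auto
      moreover have "{1..a - 1} = {1..<a}" using a1 by auto
      ultimately show ?thesis by (simp add: W_def)
    qed
    moreover have "(\<Sum>j = 1..i. lam j) = (\<Sum>j = 1..<a. lam j) + (\<Sum>j = a..i. lam j)"
    proof -
      have "{1..i} = {1..<a} \<union> {a..i}" using a by auto
      then show ?thesis by (simp add: sum.union_disjoint ivl_disj_int)
    qed
    moreover have "(\<Sum>j\<in>{j \<in> {1..<i}. u j \<le> m}. t $ e (u j)) =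
        (\<Sum>j\<in>{j \<in> {1..<a}. u j \<le> m}. t $ e (u j)) + (\<Sum>j = a..<i. t $ e (u j))"
    proof -
      have "{j \<in> {1..<i}. u j \<le> m} = {j \<in> {1..<a}. u j \<le> m} \<union> {a..<i}" using a run by auto
      then show ?thesis by (simp add: sum.union_disjoint disjoint_iff)
    qed
    moreover have "?x (?k (Suc m)) = X (Suc (?k (Suc m))) - X (?k (Suc m))" by (simp add: X_def)
    ultimately show ?thesis using Xi m
      by (simp add: upper_def upper_slack_def left_rhs_def left_lhs_def W_def a_def)
  qed
  show "lower ?k (u i - 1) t = right_lhs e r u i t - right_rhs r lam u i"
  proof -
    \<comment> \<open>The first position after the right run; it is \<open>r + 1\<close> if the run extends to the end.\<close>
    define q where "q = i + right_len r u i + 1"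
    note R = right_len_props[OF u i]
    have q: "i < q" "q \<le> r + 1" using R(1) by (auto simp: q_def)
    have run: "u j \<le> m" if "i < j" "j < q" for j using R(2)[of j] that m by (auto simp: q_def)
    have uq: "m < u q" using R(3) m by (simp add: q_def)
    have "{j \<in> {1..<q}. m < u j} = insert i {j \<in> {1..<i}. m < u j}"
    proof (intro equalityI subsetI)
      fix j assume "j \<in> {j \<in> {1..<q}. m < u j}"
      moreover from this have "\<not> i < j" using run[of j] by auto
      ultimately show "j \<in> insert i {j \<in> {1..<i}. m < u j}" by auto
    qed (use i q m in auto)
    then have "larger_before u m q = Suc (larger_before u m i)" by (simp add: larger_before_def)
    then have "X (Suc (Suc (?k (Suc m)))) = W q" using pre[of q] q uq k by simp
    moreover have "(\<Sum>j = 1..q. lam j) = (\<Sum>j = 1..i. lam j) + (\<Sum>j = i + 1..q. lam j)"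
    proof -
      have "{1..q} = {1..i} \<union> {i + 1..q}" using i q by auto
      then show ?thesis by (simp add: sum.union_disjoint ivl_disj_int)
    qed
    moreover have "(\<Sum>j\<in>{j \<in> {1..<q}. u j \<le> m}. t $ e (u j)) =
        (\<Sum>j\<in>{j \<in> {1..<i}. u j \<le> m}. t $ e (u j)) + (\<Sum>j\<in>{i<..<q}. t $ e (u j))"
    proof -
      have "{j \<in> {1..<q}. u j \<le> m} = {j \<in> {1..<i}. u j \<le> m} \<union> {i<..<q}"
      proof (intro equalityI subsetI)
        fix j assume j: "j \<in> {j \<in> {1..<q}. u j \<le> m}"
        then have "j \<noteq> i" using m by auto
        then show "j \<in> {j \<in> {1..<i}. u j \<le> m} \<union> {i<..<q}" using j by auto
      qed (use i q run in auto)
      then show ?thesis by (simp add: sum.union_disjoint disjoint_iff)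
    qed
    moreover have "{i<..<q} = {i<..i + right_len r u i}" by (auto simp: q_def)
    moreover have "?x (Suc (?k (Suc m))) = X (Suc (Suc (?k (Suc m)))) - X (Suc (?k (Suc m)))" by (simp add: X_def)
    ultimately show ?thesis using Xi m
      by (simp add: lower_def lower_slack_def right_rhs_def right_lhs_def W_def q_def del: sum.cl_ivl_Suc)
  qed
qed

text \<open>
  The constraint pair with index \<open>m\<close> belongs to position \<open>i\<close> with \<open>u i = m + 1\<close>; left inequalities are upper
  constraints and right inequalities are lower ones.
\<close>

lemma facet_description_bruhat_cube:
  assumes u: "u permutes {1..r}"
  shows "facet_description e r lam u (bruhat_cube e r lam (inv u))"
proof -
  define k where "k = code r (inv u)"
  have k: "valid_slots r k" by (simp add: k_def valid_slots_code)
  interpret cube_system "{..<r}" hyperplane "lower k" "upper k" by (rule cell_cube_system[OF k])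
  let ?P = "bruhat_cube e r lam (inv u)"
  have P: "?P = body"
    using bruhat_cube_eq_cell[OF permutes_inv[OF u]] cell_eq_body[OF k] by (simp add: k_def)
  have sl: "upper k (u i - 1) t = left_rhs lam u i - left_lhs e u i t"
    "lower k (u i - 1) t = right_lhs e r u i t - right_rhs r lam u i" if "i \<in> {1..r}" for i t
    using slacks_eq_facet_inequalities[OF u that] by (simp_all add: k_def)
  define d where "d i = u i - 1" for i
  have d: "bij_betw d {1..r} {..<r}"
  proof -
    have "bij_betw (\<lambda>x. x - 1) {1..r} {..<r}"
      by (rule bij_betw_byWitness[of _ Suc]) auto
    from bij_betw_trans[OF permutes_imp_bij[OF u] this] show ?thesis by (simp add: d_def[abs_def] o_def)
  qed
  have dI: "d i \<in> {..<r}" if "i \<in> {1..r}" for i using d that by (auto simp: bij_betw_def)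
  have d_inj: "d i = d j \<longleftrightarrow> i = j" if "i \<in> {1..r}" "j \<in> {1..r}" for i j
    using inj_on_eq_iff[of d "{1..r}" i j] d that by (simp add: bij_betw_def)
  have ineq: "(\<forall>m\<in>{..<r}. 0 \<le> lower k m t \<and> 0 \<le> upper k m t) \<longleftrightarrow>
     (\<forall>i\<in>{1..r}. left_lhs e u i t \<le> left_rhs lam u i \<and> right_lhs e r u i t \<ge> right_rhs r lam u i)" for t
  proof -
    have "{..<r} = d ` {1..r}" using d by (simp add: bij_betw_def)
    then have "(\<forall>m\<in>{..<r}. 0 \<le> lower k m t \<and> 0 \<le> upper k m t) \<longleftrightarrow>
        (\<forall>i\<in>{1..r}. 0 \<le> lower k (d i) t \<and> 0 \<le> upper k (d i) t)" by simp
    then show ?thesis using sl by (auto simp: d_def)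
  qed
  let ?f = "case_sum (\<lambda>i. {t \<in> ?P. left_lhs e u i t = left_rhs lam u i})
                 (\<lambda>i. {t \<in> ?P. right_lhs e r u i t = right_rhs r lam u i})"
  have fl: "?f (Inl i) = face {} {d i}" if "i \<in> {1..r}" for i
    using sl(1)[OF that] by (auto simp: face_def P d_def)
  have fr: "?f (Inr i) = face {d i} {}" if "i \<in> {1..r}" for i
    using sl(2)[OF that] by (auto simp: face_def P d_def)
  have facets: "F facet_of ?P \<longleftrightarrow> (\<exists>i\<in>{..<r}. F = face {i} {} \<or> F = face {} {i})" for F
    unfolding P
    using polytope_imp_polyhedron[OF polytope_bruhat_cube[of "inv u"]] by (intro facet_of_body_iff) (simp add: P)
  have "inj_on ?f ({1..r} <+> {1..r})"
  proof (rule inj_onI)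
    fix x y assume x: "x \<in> {1..r} <+> {1..r}" and y: "y \<in> {1..r} <+> {1..r}" and eq: "?f x = ?f y"
    from x y show "x = y"
    proof (elim PlusE)
      fix i j assume "x = Inl i" "y = Inl j" "i \<in> {1..r}" "j \<in> {1..r}"
      then show ?thesis using eq unfolding \<open>x = Inl i\<close> \<open>y = Inl j\<close> by (simp only: fl) (simp add: face_eq_iff dI d_inj del: lessThan_iff atLeastAtMost_iff)
    next
      fix i j assume "x = Inl i" "y = Inr j" "i \<in> {1..r}" "j \<in> {1..r}"
      then show ?thesis using eq unfolding \<open>x = Inl i\<close> \<open>y = Inr j\<close> by (simp only: fl fr) (simp add: face_eq_iff dI del: lessThan_iff atLeastAtMost_iff)
    next
      fix i j assume "x = Inr i" "y = Inl j" "i \<in> {1..r}" "j \<in> {1..r}"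
      then show ?thesis using eq unfolding \<open>x = Inr i\<close> \<open>y = Inl j\<close> by (simp only: fl fr) (simp add: face_eq_iff dI del: lessThan_iff atLeastAtMost_iff)
    next
      fix i j assume "x = Inr i" "y = Inr j" "i \<in> {1..r}" "j \<in> {1..r}"
      then show ?thesis using eq unfolding \<open>x = Inr i\<close> \<open>y = Inr j\<close> by (simp only: fr) (simp add: face_eq_iff dI d_inj del: lessThan_iff atLeastAtMost_iff)
    qed
  qed
  moreover have "?f ` ({1..r} <+> {1..r}) = {F. F facet_of ?P}"
  proof -
    have "?f ` ({1..r} <+> {1..r}) = (\<lambda>i. ?f (Inl i)) ` {1..r} \<union> (\<lambda>i. ?f (Inr i)) ` {1..r}"
      unfolding Plus_def image_Un image_image ..
    also have "\<dots> = (\<lambda>i. face {} {d i}) ` {1..r} \<union> (\<lambda>i. face {d i} {}) ` {1..r}"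
      using fl fr by (intro arg_cong2[of _ _ _ _ "(\<union>)"] image_cong) auto
    also have "\<dots> = (\<lambda>m. face {} {m}) ` d ` {1..r} \<union> (\<lambda>m. face {m} {}) ` d ` {1..r}"
      unfolding image_image ..
    also have "d ` {1..r} = {..<r}" using d by (simp add: bij_betw_def)
    finally show ?thesis using facets by auto
  qed
  moreover have "?P = {t. (\<Sum>i = 1..r + 1. t $ e i) = (\<Sum>i = 1..r + 1. lam i) \<and>
             (\<forall>i\<in>{1..r}. left_lhs e u i t \<le> left_rhs lam u i \<and>
                         right_lhs e r u i t \<ge> right_rhs r lam u i)}"
    unfolding P body_def ineq by (auto simp: hyperplane_def)
  ultimately show ?thesis unfolding facet_description_def bij_betw_def by blast
qed

end

theorem theorem6p5:
  fixes r :: nat and e :: "nat \<Rightarrow> 'n::finite" and lam :: "nat \<Rightarrow> real"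
  assumes r: "r \<ge> 1"
    and e: "bij_betw e {1..r + 1} (UNIV :: 'n set)"
    and lam: "\<forall>i\<in>{1..r}. lam i > lam (i + 1)"
  shows "card (bruhat_cube e r lam ` {u. u permutes {1..r}}) = fact r \<and>
    (\<forall>u. u permutes {1..r} \<longrightarrow> combinatorial_cube r (bruhat_cube e r lam u)) \<and>
    (\<exists>K. polyhedral_subdivision K (permutahedron e (r + 1) lam) \<and>
         maximal_faces K = bruhat_cube e r lam ` {u. u permutes {1..r}}) \<and>
    (\<forall>u. u permutes {1..r} \<longrightarrow> facet_description e r lam u (bruhat_cube e r lam (inv u)))"
proof -
  interpret labelled_weights r e lam using e lam by unfold_locales
  show ?thesis
    using card_bruhat_cubes combinatorial_cube_bruhat_cube bruhat_cubes_subdivision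
      facet_description_bruhat_cube by blast
qed

end
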